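(* Let $G$ be a Lie group which acts on the exact symplectic manifold $(M,\omega=-d\theta)$ leaving the $1$-form $\theta$ invariant, and let $H$ and $f$ be smooth, $G$-invariant functions on $M$. Denote by $J:M\to\mathfrak g^*$ the associated $G$-equivariant momentum map. Then the conformal Hamiltonian vector field $X^f_H$ with Hamiltonian $H$ and conformal parameter $f$ is a $G$-invariant vector field, and its flow preserves the ray pre-images of the associated momentum map as follows: $$J(x(t))=e^{\int_0^t -f(x(s))\,ds}\,J(x(0)),$$ for any integral curve $x$ of $X^f_H$ and any time $t$.
   Context: The momentum map is $\langle J(x),\xi\rangle=\theta(\xi_M)(x)$ for $x\in M$, $\xi\in\mathfrak g$, with $\xi_M$ the infinitesimal generator of $\xi$. A vector field $X^f_H$ on $(M,\omega=-d\theta)$ is conformal Hamiltonian with conformal parameter the smooth function $f$ and smooth Hamiltonian $H$ if $i_{X^f_H}\omega=dH-f\theta$. Ray pre-images are the sets $J^{-1}(\mathbb R^+\mu)$ with $\mathbb R^+\mu=\{r\mu:r>0\}$, $\mu\in\mathfrak g^*$.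
   Formalization: With the usual i_Xω = ω(X,·) the displayed sign is wrong (T*R, θ = p dq, translations, H=0, f=1 gives J(x(t)) = e^t J(x(0))). The formal statement takes i_Xω = ω(·,X), which makes it true; the usual convention gives e^{+∫f}, via (H,f) → (−H,−f). *)

theory Defs
  imports "HOL-Analysis.Analysis" "HOL-Algebra.Group_Action"
begin

section \<open>Smooth maps between finite-dimensional normed spaces\<close>

text \<open>
  On an open subset of a finite-dimensional space, continuity of all directional derivatives
  \<open>x \<mapsto> Df\<^sub>x v\<close> is the same as continuity of \<open>x \<mapsto> Df\<^sub>x\<close> for the operator norm, so the
  following is the usual notion of class \<open>C\<close>-\<open>k\<close>.
\<close>

primrec Ck_on :: "nat \<Rightarrow> ('a::real_normed_vector \<Rightarrow> 'b::real_normed_vector) \<Rightarrow> 'a set \<Rightarrow> bool" where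
  "Ck_on 0 f S \<longleftrightarrow> continuous_on S f"
| "Ck_on (Suc k) f S \<longleftrightarrow>
     (\<forall>x\<in>S. f differentiable (at x)) \<and> (\<forall>v. Ck_on k (\<lambda>x. frechet_derivative f (at x) v) S)"

definition smooth_on :: "('a::real_normed_vector \<Rightarrow> 'b::real_normed_vector) \<Rightarrow> 'a set \<Rightarrow> bool" where
  "smooth_on f S \<longleftrightarrow> (\<forall>k. Ck_on k f S)"


section \<open>Manifolds\<close>

text \<open>
  The model space \<open>'e\<close> is a finite-dimensional normed space rather than an instance of
  \<^class>\<open>euclidean_space\<close>, because the latter excludes dimension zero (and with it, for
  instance, finite and discrete Lie groups).  The value of a chart outside its domain is irrelevant.
\<close>

type_synonym ('m, 'e) chart = "'m set \<times> ('m \<Rightarrow> 'e)"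

record ('m, 'e) mfd =
  mtop :: "'m topology"
  charts :: "('m, 'e) chart set"

abbreviation points :: "('m, 'e) mfd \<Rightarrow> 'm set" where
  "points M \<equiv> topspace (mtop M)"

definition chart_inv :: "('m, 'e) chart \<Rightarrow> 'e \<Rightarrow> 'm" where
  "chart_inv c = inv_into (fst c) (snd c)"

definition smooth_manifold :: "('m, 'e::real_normed_vector) mfd \<Rightarrow> bool" where
  "smooth_manifold M \<longleftrightarrow>
     (\<exists>B::'e set. finite B \<and> span B = UNIV) \<and>
     Hausdorff_space (mtop M) \<and> second_countable (mtop M) \<and>
     (\<Union>c\<in>charts M. fst c) = points M \<and>
     (\<forall>c\<in>charts M. openin (mtop M) (fst c) \<and> open (snd c ` fst c) \<and>
        homeomorphic_map (subtopology (mtop M) (fst c)) (top_of_set (snd c ` fst c)) (snd c)) \<and>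
     (\<forall>c\<in>charts M. \<forall>d\<in>charts M. smooth_on (snd d \<circ> chart_inv c) (snd c ` (fst c \<inter> fst d)))"

definition prod_mfd :: "('m, 'e) mfd \<Rightarrow> ('n, 'k) mfd \<Rightarrow> ('m \<times> 'n, 'e \<times> 'k) mfd" where
  "prod_mfd M N =
     \<lparr>mtop = prod_topology (mtop M) (mtop N),
      charts = {(fst c \<times> fst d, map_prod (snd c) (snd d)) | c d. c \<in> charts M \<and> d \<in> charts N}\<rparr>"

definition smooth_map ::
  "('m, 'e::real_normed_vector) mfd \<Rightarrow> ('n, 'k::real_normed_vector) mfd \<Rightarrow> ('m \<Rightarrow> 'n) \<Rightarrow> bool" where
  "smooth_map M N F \<longleftrightarrow>
     continuous_map (mtop M) (mtop N) F \<and>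
     (\<forall>c\<in>charts M. \<forall>d\<in>charts N.
        smooth_on (snd d \<circ> F \<circ> chart_inv c) (snd c ` {p \<in> fst c. F p \<in> fst d}))"

definition smooth_fun :: "('m, 'e::real_normed_vector) mfd \<Rightarrow> ('m \<Rightarrow> real) \<Rightarrow> bool" where
  "smooth_fun M h \<longleftrightarrow> (\<forall>c\<in>charts M. smooth_on (h \<circ> chart_inv c) (snd c ` fst c))"


section \<open>Tangent vectors and differential forms\<close>

text \<open>
  A tangent vector at \<open>p\<close> is the family of its coordinate representations in all charts around
  \<open>p\<close>, related to each other by the derivatives of the transition maps.  It is \<open>0\<close> at charts not
  containing \<open>p\<close>, so that it is determined by its representation in any one chart around \<open>p\<close>.
  The vector space operations are pointwise.
\<close>

type_synonym ('m, 'e) tvec = "('m, 'e) chart \<Rightarrow> 'e"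

definition charts_at :: "('m, 'e) mfd \<Rightarrow> 'm \<Rightarrow> ('m, 'e) chart set" where
  "charts_at M p = {c \<in> charts M. p \<in> fst c}"

definition tangent_space :: "('m, 'e::real_normed_vector) mfd \<Rightarrow> 'm \<Rightarrow> ('m, 'e) tvec set" where
  "tangent_space M p = {v.
     (\<forall>c. c \<notin> charts_at M p \<longrightarrow> v c = 0) \<and>
     (\<forall>c\<in>charts_at M p. \<forall>d\<in>charts_at M p.
        v d = frechet_derivative (snd d \<circ> chart_inv c) (at (snd c p)) (v c))}"

text \<open>
  Notions that do not depend on the choice of a chart around \<open>p\<close> are defined with \<open>some_chart M p\<close>.
\<close>

definition some_chart :: "('m, 'e) mfd \<Rightarrow> 'm \<Rightarrow> ('m, 'e) chart" where
  "some_chart M p = (SOME c. c \<in> charts_at M p)"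

text \<open>The tangent vector at \<open>p\<close> whose representation in the chart \<open>c\<close> is \<open>e\<close>.\<close>

definition coord_vec ::
  "('m, 'e::real_normed_vector) mfd \<Rightarrow> ('m, 'e) chart \<Rightarrow> 'm \<Rightarrow> 'e \<Rightarrow> ('m, 'e) tvec" where
  "coord_vec M c p e = (\<lambda>d. if d \<in> charts_at M p
     then frechet_derivative (snd d \<circ> chart_inv c) (at (snd c p)) e else 0)"

definition tangent_map ::
  "('m, 'e::real_normed_vector) mfd \<Rightarrow> ('n, 'k::real_normed_vector) mfd \<Rightarrow> ('m \<Rightarrow> 'n) \<Rightarrow>
     'm \<Rightarrow> ('m, 'e) tvec \<Rightarrow> ('n, 'k) tvec" where
  "tangent_map M N F p v = (\<lambda>d. if d \<in> charts_at N (F p)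
     then let c = some_chart M p
          in frechet_derivative (snd d \<circ> F \<circ> chart_inv c) (at (snd c p)) (v c)
     else 0)"

definition differential ::
  "('m, 'e::real_normed_vector) mfd \<Rightarrow> ('m \<Rightarrow> real) \<Rightarrow> 'm \<Rightarrow> ('m, 'e) tvec \<Rightarrow> real" where
  "differential M h p v =
     (let c = some_chart M p in frechet_derivative (h \<circ> chart_inv c) (at (snd c p)) (v c))"

definition smooth_vector_field ::
  "('m, 'e::real_normed_vector) mfd \<Rightarrow> ('m \<Rightarrow> ('m, 'e) tvec) \<Rightarrow> bool" where
  "smooth_vector_field M X \<longleftrightarrow>
     (\<forall>p\<in>points M. X p \<in> tangent_space M p) \<and>
     (\<forall>c\<in>charts M. smooth_on (\<lambda>x. X (chart_inv c x) c) (snd c ` fst c))"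

definition cotangent_space ::
  "('m, 'e::real_normed_vector) mfd \<Rightarrow> 'm \<Rightarrow> (('m, 'e) tvec \<Rightarrow> real) set" where
  "cotangent_space M p = {\<alpha> \<in> extensional (tangent_space M p).
     \<forall>v\<in>tangent_space M p. \<forall>w\<in>tangent_space M p. \<forall>a b.
       \<alpha> (\<lambda>c. a *\<^sub>R v c + b *\<^sub>R w c) = a * \<alpha> v + b * \<alpha> w}"

definition form_coord ::
  "('m, 'e::real_normed_vector) mfd \<Rightarrow> ('m \<Rightarrow> ('m, 'e) tvec \<Rightarrow> real) \<Rightarrow>
     ('m, 'e) chart \<Rightarrow> 'e \<Rightarrow> 'e \<Rightarrow> real" where
  "form_coord M \<theta> c e x = \<theta> (chart_inv c x) (coord_vec M c (chart_inv c x) e)"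

definition smooth_one_form ::
  "('m, 'e::real_normed_vector) mfd \<Rightarrow> ('m \<Rightarrow> ('m, 'e) tvec \<Rightarrow> real) \<Rightarrow> bool" where
  "smooth_one_form M \<theta> \<longleftrightarrow>
     (\<forall>p\<in>points M. \<theta> p \<in> cotangent_space M p) \<and>
     (\<forall>c\<in>charts M. \<forall>e. smooth_on (form_coord M \<theta> c e) (snd c ` fst c))"

text \<open>In coordinates, \<open>d\<theta>(v, w) = D\<^sub>v(\<theta>(w)) - D\<^sub>w(\<theta>(v))\<close> for constant \<open>v\<close> and \<open>w\<close>.\<close>

definition ext_deriv ::
  "('m, 'e::real_normed_vector) mfd \<Rightarrow> ('m \<Rightarrow> ('m, 'e) tvec \<Rightarrow> real) \<Rightarrow>
     'm \<Rightarrow> ('m, 'e) tvec \<Rightarrow> ('m, 'e) tvec \<Rightarrow> real" where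
  "ext_deriv M \<theta> p v w =
     (let c = some_chart M p in
        frechet_derivative (form_coord M \<theta> c (w c)) (at (snd c p)) (v c)
      - frechet_derivative (form_coord M \<theta> c (v c)) (at (snd c p)) (w c))"

text \<open>
  The two-form \<open>-d\<theta>\<close> is automatically smooth, alternating and closed; being symplectic thus means
  being nondegenerate.
\<close>

definition symp_form ::
  "('m, 'e::real_normed_vector) mfd \<Rightarrow> ('m \<Rightarrow> ('m, 'e) tvec \<Rightarrow> real) \<Rightarrow>
     'm \<Rightarrow> ('m, 'e) tvec \<Rightarrow> ('m, 'e) tvec \<Rightarrow> real" where
  "symp_form M \<theta> p v w = - ext_deriv M \<theta> p v w"

definition exact_symplectic_manifold ::
  "('m, 'e::real_normed_vector) mfd \<Rightarrow> ('m \<Rightarrow> ('m, 'e) tvec \<Rightarrow> real) \<Rightarrow> bool" where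
  "exact_symplectic_manifold M \<theta> \<longleftrightarrow>
     smooth_manifold M \<and> smooth_one_form M \<theta> \<and>
     (\<forall>p\<in>points M. \<forall>v\<in>tangent_space M p.
        (\<forall>w\<in>tangent_space M p. symp_form M \<theta> p v w = 0) \<longrightarrow> v = (\<lambda>_. 0))"


section \<open>Lie group actions and momentum maps\<close>

definition lie_group :: "('g, 'z) monoid_scheme \<Rightarrow> ('g, 'h::real_normed_vector) mfd \<Rightarrow> bool" where
  "lie_group G L \<longleftrightarrow>
     group G \<and> smooth_manifold L \<and> points L = carrier G \<and>
     smooth_map (prod_mfd L L) L (\<lambda>(g, h). g \<otimes>\<^bsub>G\<^esub> h) \<and>
     smooth_map L L (\<lambda>g. inv\<^bsub>G\<^esub> g)"

definition smooth_action ::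
  "('g, 'z) monoid_scheme \<Rightarrow> ('g, 'h::real_normed_vector) mfd \<Rightarrow>
     ('m, 'e::real_normed_vector) mfd \<Rightarrow> ('g \<Rightarrow> 'm \<Rightarrow> 'm) \<Rightarrow> bool" where
  "smooth_action G L M \<Phi> \<longleftrightarrow>
     group_action G (points M) \<Phi> \<and> smooth_map (prod_mfd L M) M (\<lambda>(g, p). \<Phi> g p)"

definition invariant_fun ::
  "('g, 'z) monoid_scheme \<Rightarrow> ('m, 'e) mfd \<Rightarrow> ('g \<Rightarrow> 'm \<Rightarrow> 'm) \<Rightarrow> ('m \<Rightarrow> real) \<Rightarrow> bool" where
  "invariant_fun G M \<Phi> h \<longleftrightarrow> (\<forall>g\<in>carrier G. \<forall>p\<in>points M. h (\<Phi> g p) = h p)"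

definition invariant_one_form ::
  "('g, 'z) monoid_scheme \<Rightarrow> ('m, 'e::real_normed_vector) mfd \<Rightarrow> ('g \<Rightarrow> 'm \<Rightarrow> 'm) \<Rightarrow>
     ('m \<Rightarrow> ('m, 'e) tvec \<Rightarrow> real) \<Rightarrow> bool" where
  "invariant_one_form G M \<Phi> \<theta> \<longleftrightarrow>
     (\<forall>g\<in>carrier G. \<forall>p\<in>points M. \<forall>v\<in>tangent_space M p.
        \<theta> (\<Phi> g p) (tangent_map M M (\<Phi> g) p v) = \<theta> p v)"

definition invariant_vector_field ::
  "('g, 'z) monoid_scheme \<Rightarrow> ('m, 'e::real_normed_vector) mfd \<Rightarrow> ('g \<Rightarrow> 'm \<Rightarrow> 'm) \<Rightarrow>
     ('m \<Rightarrow> ('m, 'e) tvec) \<Rightarrow> bool" where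
  "invariant_vector_field G M \<Phi> X \<longleftrightarrow>
     (\<forall>g\<in>carrier G. \<forall>p\<in>points M. X (\<Phi> g p) = tangent_map M M (\<Phi> g) p (X p))"

definition lie_algebra ::
  "('g, 'z) monoid_scheme \<Rightarrow> ('g, 'h::real_normed_vector) mfd \<Rightarrow> ('g, 'h) tvec set" where
  "lie_algebra G L = tangent_space L \<one>\<^bsub>G\<^esub>"

definition lie_coalgebra ::
  "('g, 'z) monoid_scheme \<Rightarrow> ('g, 'h::real_normed_vector) mfd \<Rightarrow> (('g, 'h) tvec \<Rightarrow> real) set" where
  "lie_coalgebra G L = cotangent_space L \<one>\<^bsub>G\<^esub>"

text \<open>
  \<open>\<xi>\<^sub>M(p)\<close> is the image of \<open>\<xi>\<close> under the derivative at the identity of the orbit map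
  \<open>g \<mapsto> g \<cdot> p\<close>.
\<close>

definition inf_generator ::
  "('g, 'z) monoid_scheme \<Rightarrow> ('g, 'h::real_normed_vector) mfd \<Rightarrow>
     ('m, 'e::real_normed_vector) mfd \<Rightarrow> ('g \<Rightarrow> 'm \<Rightarrow> 'm) \<Rightarrow> ('g, 'h) tvec \<Rightarrow> 'm \<Rightarrow> ('m, 'e) tvec" where
  "inf_generator G L M \<Phi> \<xi> p = tangent_map L M (\<lambda>g. \<Phi> g p) \<one>\<^bsub>G\<^esub> \<xi>"

definition momentum_map ::
  "('g, 'z) monoid_scheme \<Rightarrow> ('g, 'h::real_normed_vector) mfd \<Rightarrow>
     ('m, 'e::real_normed_vector) mfd \<Rightarrow> ('g \<Rightarrow> 'm \<Rightarrow> 'm) \<Rightarrow> ('m \<Rightarrow> ('m, 'e) tvec \<Rightarrow> real) \<Rightarrow>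
     'm \<Rightarrow> ('g, 'h) tvec \<Rightarrow> real" where
  "momentum_map G L M \<Phi> \<theta> p = (\<lambda>\<xi>\<in>lie_algebra G L. \<theta> p (inf_generator G L M \<Phi> \<xi> p))"

definition coalg_scale ::
  "('g, 'z) monoid_scheme \<Rightarrow> ('g, 'h::real_normed_vector) mfd \<Rightarrow> real \<Rightarrow>
     (('g, 'h) tvec \<Rightarrow> real) \<Rightarrow> ('g, 'h) tvec \<Rightarrow> real" where
  "coalg_scale G L r \<mu> = (\<lambda>\<xi>\<in>lie_algebra G L. r * \<mu> \<xi>)"

definition ray_preimage ::
  "('g, 'z) monoid_scheme \<Rightarrow> ('g, 'h::real_normed_vector) mfd \<Rightarrow>
     ('m, 'e::real_normed_vector) mfd \<Rightarrow> ('g \<Rightarrow> 'm \<Rightarrow> 'm) \<Rightarrow> ('m \<Rightarrow> ('m, 'e) tvec \<Rightarrow> real) \<Rightarrow>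
     (('g, 'h) tvec \<Rightarrow> real) \<Rightarrow> 'm set" where
  "ray_preimage G L M \<Phi> \<theta> \<mu> =
     {p \<in> points M. momentum_map G L M \<Phi> \<theta> p \<in> {coalg_scale G L r \<mu> | r. r > 0}}"


section \<open>Conformal Hamiltonian vector fields and integral curves\<close>

text \<open>
  Sign convention: \<open>(i\<^sub>X \<omega>)(v) = \<omega>(v, X)\<close>.  The convention matters.  From \<open>\<omega> = -d\<theta>\<close>,
  \<open>i\<^sub>X \<omega> = dH - f\<theta>\<close> and \<open>J\<^sub>\<xi> = \<theta>(\<xi>\<^sub>M)\<close> one obtains \<open>dJ\<^sub>\<xi>(X) = \<omega>(\<xi>\<^sub>M, X) = -f J\<^sub>\<xi>\<close>, that is,
  \<open>J(x(t)) = exp(- \<integral>f) J(x(0))\<close>.  Contracting the first slot instead amounts to replacing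
  \<open>(H, f)\<close> by \<open>(-H, -f)\<close> and yields \<open>J(x(t)) = exp(+ \<integral>f) J(x(0))\<close>.
\<close>

definition interior_product ::
  "('m \<Rightarrow> ('m, 'e) tvec) \<Rightarrow> ('m \<Rightarrow> ('m, 'e) tvec \<Rightarrow> ('m, 'e) tvec \<Rightarrow> real) \<Rightarrow>
     'm \<Rightarrow> ('m, 'e) tvec \<Rightarrow> real" where
  "interior_product X \<omega> p v = \<omega> p v (X p)"

definition conformal_hamiltonian ::
  "('m, 'e::real_normed_vector) mfd \<Rightarrow> ('m \<Rightarrow> ('m, 'e) tvec \<Rightarrow> real) \<Rightarrow>
     ('m \<Rightarrow> real) \<Rightarrow> ('m \<Rightarrow> real) \<Rightarrow> ('m \<Rightarrow> ('m, 'e) tvec) \<Rightarrow> bool" where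
  "conformal_hamiltonian M \<theta> H f X \<longleftrightarrow>
     smooth_vector_field M X \<and>
     (\<forall>p\<in>points M. \<forall>v\<in>tangent_space M p.
        interior_product X (symp_form M \<theta>) p v = differential M H p v - f p * \<theta> p v)"

text \<open>
  Continuity of the curve is a separate requirement because charts are arbitrary functions outside
  their domains.
\<close>

definition integral_curve ::
  "('m, 'e::real_normed_vector) mfd \<Rightarrow> ('m \<Rightarrow> ('m, 'e) tvec) \<Rightarrow> real set \<Rightarrow> (real \<Rightarrow> 'm) \<Rightarrow> bool" where
  "integral_curve M X I x \<longleftrightarrow>
     open I \<and> is_interval I \<and> continuous_map (top_of_set I) (mtop M) x \<and>
     (\<forall>t\<in>I. \<forall>c\<in>charts_at M (x t). ((snd c \<circ> x) has_vector_derivative X (x t) c) (at t))"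

end

theory Submission
  imports Defs
begin

text \<open>
  Invariance of \<open>\<theta>\<close> gives invariance of \<open>\<omega> = -d\<theta>\<close>; as \<open>\<omega>\<close> is nondegenerate and \<open>H\<close>, \<open>f\<close>, \<open>\<theta>\<close> are
  invariant, so is the solution \<open>X\<close> of \<open>i\<^sub>X \<omega> = dH - f\<theta>\<close>.  Invariance of \<open>\<theta>\<close> under the flow of
  \<open>\<xi>\<^sub>M\<close> gives \<open>dJ\<^sub>\<xi> = d\<theta>(\<cdot>, \<xi>\<^sub>M)\<close>, and \<open>dH(\<xi>\<^sub>M) = 0\<close>; hence
  \<open>dJ\<^sub>\<xi>(X) = \<omega>(\<xi>\<^sub>M, X) = -f J\<^sub>\<xi>\<close>, a scalar linear differential equation along integral curves of \<open>X\<close>.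
  Both facts about \<open>\<theta>\<close> are instances of the naturality of \<open>d\<close> in coordinates: for the maps
  \<open>x \<mapsto> g \<cdot> x\<close> and \<open>(g, x) \<mapsto> g \<cdot> x\<close>, respectively.
\<close>


section \<open>Finite-dimensional normed spaces\<close>

text \<open>\<open>smooth_one_form\<close> controls \<open>form_coord M \<theta> c e\<close> for one
  fixed vector e at a time, whereas a pullback evaluates the form on a vector that moves with the
  point. Finite dimension reconciles the two: by linearity in e, the moving evaluation is a finite
  sum of products with bounded coordinate functionals. The model space is a normed space with a
  finite spanning set, so these functionals come from a basis extracted from that set.

  Differentiating \<theta>(\<xi>_M) directly produces derivatives of \<xi>_M, and Cartan's formula
  would call for its flow. Keeping the group variable as a coordinate avoids both: in a product
  chart \<xi> is a constant direction, and invariance under each single group element takes the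
  place of invariance under a flow.\<close>

lemma closed_subspace_coefficient_bound:
  fixes S :: "'a::real_normed_vector set"
  assumes "subspace S" "closed S" "b \<notin> S"
  obtains \<delta> where "\<delta> > 0" "\<And>k x. x - k *\<^sub>R b \<in> S \<Longrightarrow> \<bar>k\<bar> * \<delta> \<le> norm x"
proof
  have ne: "S \<noteq> {}" using assms(1) subspace_0 by blast
  show "infdist b S > 0"
    using assms ne by (intro infdist_pos_not_in_closed)
  fix k x assume x: "x - k *\<^sub>R b \<in> S"
  show "\<bar>k\<bar> * infdist b S \<le> norm x"
  proof (cases "k = 0")
    case False
    \<comment> \<open>Write x = s + k b with s in S. Dividing by k makes norm x / |k| the distance
      from b to the point - s / k of S, hence at least \<open>infdist b S\<close>.\<close>
    have "(- 1 / k) *\<^sub>R (x - k *\<^sub>R b) \<in> S"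
      using assms(1) x by (rule subspace_scale)
    then have "infdist b S \<le> dist b ((- 1 / k) *\<^sub>R (x - k *\<^sub>R b))"
      by (rule infdist_le)
    also have "\<dots> = norm ((1 / k) *\<^sub>R x)"
      using False by (simp add: dist_norm algebra_simps)
    finally show ?thesis using False by (simp add: field_simps)
  qed simp
qed

text \<open>Induction on the generators. For a new b, the preceding bound makes the coefficients of
  b Cauchy along a convergent sequence; subtracting their limit times b leaves a limit in the
  smaller span, which is closed.\<close>

lemma closed_span_finite:
  fixes B :: "'a::real_normed_vector set"
  assumes "finite B"
  shows "closed (span B)"
  using assms
proof (induction B)
  case (insert b B)
  show ?case
  proof (cases "b \<in> span B")
    case True
    then show ?thesis using insert.IH by (simp add: span_redundant)
  next
    case False
    obtain \<delta> where \<delta>: "\<delta> > 0" "\<And>k x. x - k *\<^sub>R b \<in> span B \<Longrightarrow> \<bar>k\<bar> * \<delta> \<le> norm x"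
      using closed_subspace_coefficient_bound[OF subspace_span insert.IH False] by blast
    show ?thesis
      unfolding closed_sequential_limits
    proof (intro allI impI, elim conjE)
      fix y l assume y: "\<forall>n. y n \<in> span (insert b B)" and lim: "y \<longlonglongrightarrow> l"
      have "\<forall>n. \<exists>k. y n - k *\<^sub>R b \<in> span B" using y by (simp add: span_breakdown_eq)
      then obtain k where k: "\<And>n. y n - k n *\<^sub>R b \<in> span B" by metis
      have bd: "\<bar>k m - k n\<bar> * \<delta> \<le> norm (y m - y n)" for m n
      proof (rule \<delta>(2))
        have "y m - y n - (k m - k n) *\<^sub>R b = (y m - k m *\<^sub>R b) - (y n - k n *\<^sub>R b)"
          by (simp add: algebra_simps)
        then show "y m - y n - (k m - k n) *\<^sub>R b \<in> span B"
          using span_diff[OF k k] by metis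
      qed
      have "Cauchy k"
        unfolding Cauchy_def
      proof (intro allI impI)
        fix e :: real assume "e > 0"
        then have "e * \<delta> > 0" using \<delta> by simp
        then obtain N where N: "\<And>m n. m \<ge> N \<Longrightarrow> n \<ge> N \<Longrightarrow> dist (y m) (y n) < e * \<delta>"
          using LIMSEQ_imp_Cauchy[OF lim] unfolding Cauchy_def by metis
        show "\<exists>N. \<forall>m\<ge>N. \<forall>n\<ge>N. dist (k m) (k n) < e"
        proof (intro exI[of _ N] allI impI)
          fix m n assume "m \<ge> N" "n \<ge> N"
          then have "\<bar>k m - k n\<bar> * \<delta> < e * \<delta>"
            using N[of m n] bd[of m n] by (simp add: dist_norm)
          then show "dist (k m) (k n) < e" using \<delta>(1) by (simp add: dist_real_def)
        qed
      qed
      then obtain k0 where "k \<longlonglongrightarrow> k0"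
        using real_Cauchy_convergent convergent_def by blast
      then have "(\<lambda>n. y n - k n *\<^sub>R b) \<longlonglongrightarrow> l - k0 *\<^sub>R b"
        using lim by (intro tendsto_intros)
      then have "l - k0 *\<^sub>R b \<in> span B"
        by (rule closed_sequentially[OF insert.IH k])
      then show "l \<in> span (insert b B)" by (auto simp: span_breakdown_eq)
    qed
  qed
qed simp

text \<open>The coefficient of a basis vector b is bounded because the span of the other basis
  vectors is closed and misses b.\<close>

lemma bounded_linear_coordinates:
  fixes B :: "'a::real_normed_vector set"
  assumes "finite B" "span B = UNIV"
  obtains C :: "'a set" and \<kappa> :: "'a \<Rightarrow> 'a \<Rightarrow> real"
  where "finite C" "\<And>b. bounded_linear (\<kappa> b)" "\<And>x. x = (\<Sum>b\<in>C. \<kappa> b x *\<^sub>R b)"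
proof -
  obtain C where C: "C \<subseteq> B" "independent C" "B \<subseteq> span C"
    by (rule real_vector.maximal_independent_subset)
  have fin: "finite C" using C(1) assms(1) finite_subset by blast
  have sp: "span C = UNIV"
    using span_mono[OF C(3)] assms(2) by (simp add: span_span top.extremum_uniqueI)
  \<comment> \<open>The value zero outside C makes \<open>\<kappa> b\<close> bounded linear for
    every b, without a side condition.\<close>
  define \<kappa> where "\<kappa> b x = (if b \<in> C then representation C x b else 0)" for b x
  have eq: "x = (\<Sum>b\<in>C. \<kappa> b x *\<^sub>R b)" for x
    using real_vector.sum_representation_eq[OF C(2), of x C] fin sp by (simp add: \<kappa>_def)
  have "bounded_linear (\<kappa> b)" for b
  proof (cases "b \<in> C")
    case True
    have "b \<notin> span (C - {b})" using C(2) True by (auto simp: dependent_def)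
    then obtain \<delta> where \<delta>: "\<delta> > 0" "\<And>k x. x - k *\<^sub>R b \<in> span (C - {b}) \<Longrightarrow> \<bar>k\<bar> * \<delta> \<le> norm x"
      using closed_subspace_coefficient_bound[OF subspace_span closed_span_finite] fin
      by (metis finite_Diff)
    show ?thesis
    proof (rule bounded_linear_intro)
      fix x y :: 'a and r :: real
      show "\<kappa> b (x + y) = \<kappa> b x + \<kappa> b y"
        using C(2) sp by (simp add: \<kappa>_def real_vector.representation_add)
      show "\<kappa> b (r *\<^sub>R x) = r *\<^sub>R \<kappa> b x"
        using C(2) sp by (simp add: \<kappa>_def real_vector.representation_scale)
      have "x - \<kappa> b x *\<^sub>R b = (\<Sum>c\<in>C - {b}. \<kappa> c x *\<^sub>R c)"
        by (subst (1) eq[of x]) (simp add: sum.remove[OF fin True])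
      also have "\<dots> \<in> span (C - {b})"
        by (intro span_sum span_scale span_base)
      finally have "\<bar>\<kappa> b x\<bar> * \<delta> \<le> norm x" by (rule \<delta>(2))
      then show "norm (\<kappa> b x) \<le> norm x * (1 / \<delta>)"
        using \<delta>(1) by (simp add: field_simps)
    qed
  next
    case False
    then have "\<kappa> b = (\<lambda>_. 0)" by (simp add: \<kappa>_def fun_eq_iff)
    then show ?thesis by simp
  qed
  then show thesis using that fin eq by blast
qed

lemma linear_imp_bounded_linear_finite_span:
  fixes f :: "'a::real_normed_vector \<Rightarrow> 'b::real_normed_vector"
  assumes "finite B" "span B = (UNIV :: 'a set)" "linear f"
  shows "bounded_linear f"
proof -
  obtain C :: "'a set" and \<kappa> where \<kappa>: "finite C" "\<And>b. bounded_linear (\<kappa> b)"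
    "\<And>x. x = (\<Sum>b\<in>C. \<kappa> b x *\<^sub>R b)"
    using bounded_linear_coordinates[OF assms(1,2)] by metis
  have "f x = (\<Sum>b\<in>C. \<kappa> b x *\<^sub>R f b)" for x
    by (subst \<kappa>(3)[of x]) (simp add: linear_sum[OF assms(3)] linear_cmul[OF assms(3)])
  then have "f = (\<lambda>x. \<Sum>b\<in>C. \<kappa> b x *\<^sub>R f b)" by blast
  moreover have "bounded_linear (\<lambda>x. \<Sum>b\<in>C. \<kappa> b x *\<^sub>R f b)"
    using \<kappa>(2) by (intro bounded_linear_sum bounded_linear_scaleR_const)
  ultimately show ?thesis by simp
qed

text \<open>A product rule under differentiability of A for each fixed e only: expanding
  \<open>w y\<close> in coordinates gives finitely many products of real functions.\<close>

lemma has_derivative_linear_family: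
  fixes A :: "'a::real_normed_vector \<Rightarrow> 'e::real_normed_vector \<Rightarrow> real"
  assumes fin: "finite B" "span B = (UNIV :: 'e set)"
    and S: "open S" "z \<in> S"
    and lin: "\<And>y. y \<in> S \<Longrightarrow> linear (A y)"
    and A': "\<And>e. ((\<lambda>y. A y e) has_derivative A' e) (at z)"
    and w': "(w has_derivative w') (at z)"
  shows "((\<lambda>y. A y (w y)) has_derivative (\<lambda>u. A' (w z) u + A z (w' u))) (at z)"
proof -
  obtain C :: "'e set" and \<kappa> where \<kappa>: "finite C" "\<And>b. bounded_linear (\<kappa> b)"
    "\<And>x. x = (\<Sum>b\<in>C. \<kappa> b x *\<^sub>R b)"
    using bounded_linear_coordinates[OF fin] by metis
  have eq: "A y e = (\<Sum>b\<in>C. \<kappa> b e * A y b)" if "y \<in> S" for y e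
    by (subst \<kappa>(3)[of e]) (simp add: linear_sum[OF lin[OF that]] linear_cmul[OF lin[OF that]])
  have "((\<lambda>y. \<Sum>b\<in>C. \<kappa> b e * A y b) has_derivative (\<lambda>u. \<Sum>b\<in>C. \<kappa> b e * A' b u)) (at z)" for e
    by (intro has_derivative_sum has_derivative_mult_right A')
  then have "((\<lambda>y. A y e) has_derivative (\<lambda>u. \<Sum>b\<in>C. \<kappa> b e * A' b u)) (at z)" for e
    by (rule has_derivative_transform_within_open[OF _ S]) (simp add: eq)
  \<comment> \<open>Uniqueness of derivatives passes the expansion in e on to \<open>A'\<close>, so
    that the summands recombine into \<open>A' (w z)\<close>.\<close>
  then have A'eq: "A' e = (\<lambda>u. \<Sum>b\<in>C. \<kappa> b e * A' b u)" for e
    using A' has_derivative_unique by blast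
  have "((\<lambda>y. \<Sum>b\<in>C. \<kappa> b (w y) * A y b) has_derivative
      (\<lambda>u. \<Sum>b\<in>C. \<kappa> b (w z) * A' b u + \<kappa> b (w' u) * A z b)) (at z)"
    by (intro has_derivative_sum has_derivative_mult A' bounded_linear.has_derivative[OF \<kappa>(2)] w')
  moreover have "(\<lambda>u. \<Sum>b\<in>C. \<kappa> b (w z) * A' b u + \<kappa> b (w' u) * A z b)
      = (\<lambda>u. A' (w z) u + A z (w' u))"
    by (rule ext, subst A'eq[of "w z"], subst eq[OF S(2)]) (simp add: sum.distrib)
  ultimately have "((\<lambda>y. \<Sum>b\<in>C. \<kappa> b (w y) * A y b) has_derivative
      (\<lambda>u. A' (w z) u + A z (w' u))) (at z)" by simp
  then show ?thesis
    by (rule has_derivative_transform_within_open[OF _ S]) (simp add: eq)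
qed


section \<open>Symmetry of second derivatives\<close>

text \<open>The mean value theorem in direction v turns the second difference into h times an
  increment of the v-derivative; differentiability of that derivative at x evaluates the increment
  up to o(h).\<close>

lemma second_difference_quotient_tendsto:
  fixes f :: "'a::real_normed_vector \<Rightarrow> real"
  assumes S: "open S" "x \<in> S"
    and f: "\<And>y. y \<in> S \<Longrightarrow> f differentiable (at y)"
    and D: "((\<lambda>y. frechet_derivative f (at y) v) has_derivative D) (at x)"
  shows "((\<lambda>h. (f (x + h *\<^sub>R u + h *\<^sub>R v) - f (x + h *\<^sub>R u) - f (x + h *\<^sub>R v) + f x) / h\<^sup>2)
           \<longlongrightarrow> D u) (at_right 0)"
proof (rule tendstoI)
  fix \<epsilon> :: real assume \<epsilon>: "\<epsilon> > 0"
  define N where "N = norm u + norm v"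
  have N: "N \<ge> 0" by (simp add: N_def)
  \<comment> \<open>Two errors of size \<eta> h N arise, and after division by h their sum 2 \<eta>
    N must stay below \<epsilon>. The 1 keeps the denominator positive when N = 0.\<close>
  define \<eta> where "\<eta> = \<epsilon> / (2 * N + 1)"
  have \<eta>: "\<eta> > 0" using \<epsilon> N by (simp add: \<eta>_def)
  have \<eta>N: "2 * \<eta> * N < \<epsilon>" using \<epsilon> N by (simp add: \<eta>_def field_simps)
  let ?g = "\<lambda>y. frechet_derivative f (at y) v"
  obtain d1 where d1: "d1 > 0" "\<And>y. norm (y - x) < d1 \<Longrightarrow> norm (?g y - ?g x - D (y - x)) \<le> \<eta> * norm (y - x)"
    using D \<eta> unfolding has_derivative_at_alt by metis
  obtain d2 where d2: "d2 > 0" "\<And>y. norm (y - x) < d2 \<Longrightarrow> y \<in> S"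
    using S by (metis open_dist dist_norm)
  \<comment> \<open>The points x + a u + b v with a, b between 0 and h lie within h N of x. For h <
    d they stay in S and in the ball where the linear approximation holds.\<close>
  define d where "d = min d1 d2 / (N + 1)"
  have d: "d > 0" using d1(1) d2(1) N by (simp add: d_def)
  interpret D: bounded_linear D using D by (rule has_derivative_bounded_linear)
  have key: "dist ((f (x + h *\<^sub>R u + h *\<^sub>R v) - f (x + h *\<^sub>R u) - f (x + h *\<^sub>R v) + f x) / h\<^sup>2) (D u) < \<epsilon>"
    if h: "0 < h" "h < d" for h
  proof -
    have "h * (N + 1) < min d1 d2" using h(2) N by (simp add: d_def pos_less_divide_eq)
    then have hN: "h * N < d1" "h * N < d2" using h(1) by (simp_all add: algebra_simps)
    have near: "norm (a *\<^sub>R u + b *\<^sub>R v) \<le> h * N" if "0 \<le> a" "a \<le> h" "0 \<le> b" "b \<le> h" for a b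
    proof -
      have "norm (a *\<^sub>R u + b *\<^sub>R v) \<le> a * norm u + b * norm v"
        using norm_triangle_ineq[of "a *\<^sub>R u" "b *\<^sub>R v"] that by simp
      also have "\<dots> \<le> h * norm u + h * norm v"
        using that by (intro add_mono mult_right_mono) auto
      finally show ?thesis by (simp add: N_def algebra_simps)
    qed
    have inS: "x + a *\<^sub>R u + b *\<^sub>R v \<in> S" if "0 \<le> a" "a \<le> h" "0 \<le> b" "b \<le> h" for a b
      using near[OF that] hN d2(2)[of "x + a *\<^sub>R u + b *\<^sub>R v"] by (simp add: add.assoc)
    have der: "((\<lambda>t. f (x + a *\<^sub>R u + t *\<^sub>R v)) has_real_derivative ?g (x + a *\<^sub>R u + t *\<^sub>R v)) (at t)"
      if "0 \<le> a" "a \<le> h" "0 \<le> t" "t \<le> h" for a t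
    proof -
      let ?p = "x + a *\<^sub>R u + t *\<^sub>R v"
      have fd: "(f has_derivative frechet_derivative f (at ?p)) (at ?p)"
        using f[OF inS[OF that]] frechet_derivative_works by blast
      have "((\<lambda>t. x + a *\<^sub>R u + t *\<^sub>R v) has_derivative (\<lambda>s. s *\<^sub>R v)) (at t)"
        by (auto intro!: derivative_eq_intros)
      from has_derivative_compose[OF this fd]
      have "((\<lambda>t. f (x + a *\<^sub>R u + t *\<^sub>R v)) has_derivative (\<lambda>s. frechet_derivative f (at ?p) (s *\<^sub>R v))) (at t)" .
      moreover have "frechet_derivative f (at ?p) (s *\<^sub>R v) = ?g ?p * s" for s
        using bounded_linear.linear[OF has_derivative_bounded_linear[OF fd]] by (simp add: linear_cmul)
      ultimately show ?thesis by (simp add: has_field_derivative_def)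
    qed
    \<comment> \<open>The difference of f along two parallel segments; the summand
      \<open>0 *\<^sub>R u\<close> makes the second one the case a = 0 of
      \<open>der\<close>.\<close>
    let ?\<phi> = "\<lambda>t. f (x + h *\<^sub>R u + t *\<^sub>R v) - f (x + 0 *\<^sub>R u + t *\<^sub>R v)"
    have der2: "(?\<phi> has_real_derivative ?g (x + h *\<^sub>R u + t *\<^sub>R v) - ?g (x + 0 *\<^sub>R u + t *\<^sub>R v)) (at t)"
      if "0 \<le> t" "t \<le> h" for t
      using that h(1) by (intro DERIV_diff der) auto
    obtain \<tau> where \<tau>: "0 < \<tau>" "\<tau> < h"
      "?\<phi> h - ?\<phi> 0 = (h - 0) * (?g (x + h *\<^sub>R u + \<tau> *\<^sub>R v) - ?g (x + 0 *\<^sub>R u + \<tau> *\<^sub>R v))"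
      using MVT2[OF h(1) der2] by blast
    have e: "norm (?g (x + a *\<^sub>R u + \<tau> *\<^sub>R v) - ?g x - D (a *\<^sub>R u + \<tau> *\<^sub>R v)) \<le> \<eta> * (h * N)"
      if "0 \<le> a" "a \<le> h" for a
    proof -
      have n: "norm (a *\<^sub>R u + \<tau> *\<^sub>R v) \<le> h * N" using near[of a \<tau>] that \<tau> by simp
      then have "norm (?g (x + a *\<^sub>R u + \<tau> *\<^sub>R v) - ?g x - D (a *\<^sub>R u + \<tau> *\<^sub>R v))
          \<le> \<eta> * norm (a *\<^sub>R u + \<tau> *\<^sub>R v)"
        using d1(2)[of "x + a *\<^sub>R u + \<tau> *\<^sub>R v"] hN by (simp add: add.assoc)
      also have "\<dots> \<le> \<eta> * (h * N)" using n \<eta> by simp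
      finally show ?thesis .
    qed
    let ?\<Delta> = "f (x + h *\<^sub>R u + h *\<^sub>R v) - f (x + h *\<^sub>R u) - f (x + h *\<^sub>R v) + f x"
    have eq: "?\<Delta> = h * (?g (x + h *\<^sub>R u + \<tau> *\<^sub>R v) - ?g (x + 0 *\<^sub>R u + \<tau> *\<^sub>R v))"
      using \<tau>(3) by simp
    \<comment> \<open>The values of D at h u + \<tau> v and at \<tau> v differ by h D u, so the
      unknown \<tau> drops out.\<close>
    have "\<bar>?g (x + h *\<^sub>R u + \<tau> *\<^sub>R v) - ?g (x + 0 *\<^sub>R u + \<tau> *\<^sub>R v) - h * D u\<bar> \<le> 2 * \<eta> * N * h"
      using e[of h] e[of 0] h(1) by (simp add: D.add D.scaleR algebra_simps)
    then have "\<bar>(?g (x + h *\<^sub>R u + \<tau> *\<^sub>R v) - ?g (x + 0 *\<^sub>R u + \<tau> *\<^sub>R v) - h * D u) / h\<bar> \<le> 2 * \<eta> * N"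
      using h(1) by (simp add: pos_divide_le_eq del: scaleR_zero_left)
    moreover have "?\<Delta> / h\<^sup>2 - D u
        = (?g (x + h *\<^sub>R u + \<tau> *\<^sub>R v) - ?g (x + 0 *\<^sub>R u + \<tau> *\<^sub>R v) - h * D u) / h"
      using h(1) unfolding eq by (simp add: field_simps power2_eq_square)
    ultimately have "\<bar>?\<Delta> / h\<^sup>2 - D u\<bar> \<le> 2 * \<eta> * N" by metis
    then show ?thesis using \<eta>N by (simp add: dist_real_def)
  qed
  then show "\<forall>\<^sub>F h in at_right 0. dist ((f (x + h *\<^sub>R u + h *\<^sub>R v) - f (x + h *\<^sub>R u) - f (x + h *\<^sub>R v) + f x) / h\<^sup>2) (D u) < \<epsilon>"
    unfolding eventually_at_right_field using d by blast
qed

text \<open>The second difference is symmetric in u and v, so one and the same quotient converges to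
  both values.\<close>

lemma second_derivative_symmetric:
  fixes f :: "'a::real_normed_vector \<Rightarrow> real"
  assumes "open S" "x \<in> S"
    and "\<And>y. y \<in> S \<Longrightarrow> f differentiable (at y)"
    and "((\<lambda>y. frechet_derivative f (at y) u) has_derivative Du) (at x)"
    and "((\<lambda>y. frechet_derivative f (at y) v) has_derivative Dv) (at x)"
  shows "Du v = Dv u"
proof (rule tendsto_unique[OF trivial_limit_at_right_real])
  show "((\<lambda>h. (f (x + h *\<^sub>R u + h *\<^sub>R v) - f (x + h *\<^sub>R u) - f (x + h *\<^sub>R v) + f x) / h\<^sup>2)
           \<longlongrightarrow> Dv u) (at_right 0)"
    by (rule second_difference_quotient_tendsto[OF assms(1-3,5)])
  show "((\<lambda>h. (f (x + h *\<^sub>R u + h *\<^sub>R v) - f (x + h *\<^sub>R u) - f (x + h *\<^sub>R v) + f x) / h\<^sup>2)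
           \<longlongrightarrow> Du v) (at_right 0)"
    using second_difference_quotient_tendsto[OF assms(1-4), of v]
    by (simp add: algebra_simps)
qed

text \<open>
  Naturality of the exterior derivative in coordinates: \<open>d(F\<^sup>*A) = F\<^sup>*(dA)\<close>.  The terms with second
  derivatives of \<open>F\<close> cancel by symmetry.
\<close>

lemma pullback_derivative:
  fixes F :: "'a::real_normed_vector \<Rightarrow> 'e::real_normed_vector" and A :: "'e \<Rightarrow> 'e \<Rightarrow> real"
  assumes fin: "finite B" "span B = (UNIV :: 'e set)"
    and S: "open S" "z \<in> S"
    and F: "\<And>y. y \<in> S \<Longrightarrow> F differentiable (at y)"
    and F2: "\<And>w. (\<lambda>y. frechet_derivative F (at y) w) differentiable (at z)"
    and lin: "\<And>y. y \<in> S \<Longrightarrow> linear (A (F y))"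
    and A: "\<And>e. (\<lambda>y. A y e) differentiable (at (F z))"
  defines "P \<equiv> \<lambda>w y. A (F y) (frechet_derivative F (at y) w)"
    and "DF \<equiv> frechet_derivative F (at z)"
  shows "P w differentiable (at z)"
    and "frechet_derivative (P w) (at z) u - frechet_derivative (P u) (at z) w
      = frechet_derivative (\<lambda>y. A y (DF w)) (at (F z)) (DF u)
      - frechet_derivative (\<lambda>y. A y (DF u)) (at (F z)) (DF w)"
proof -
  define D2 where "D2 w = frechet_derivative (\<lambda>y. frechet_derivative F (at y) w) (at z)" for w
  have D2: "((\<lambda>y. frechet_derivative F (at y) w) has_derivative D2 w) (at z)" for w
    using F2 frechet_derivative_works unfolding D2_def by blast
  have DF: "(F has_derivative DF) (at z)"
    using F[OF S(2)] frechet_derivative_works unfolding DF_def by blast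
  define DA where "DA e = frechet_derivative (\<lambda>y. A y e) (at (F z))" for e
  have DA: "((\<lambda>y. A y e) has_derivative DA e) (at (F z))" for e
    using A frechet_derivative_works unfolding DA_def by blast
  \<comment> \<open>The first summand comes from moving the form, the second from the second
    derivative of F; only the first survives antisymmetrisation in u and w.\<close>
  have P: "(P w has_derivative (\<lambda>u. DA (DF w) (DF u) + A (F z) (D2 w u))) (at z)" for w
    unfolding P_def DF_def
    unfolding P_def
    using has_derivative_linear_family[where A = "\<lambda>y. A (F y)", OF fin S lin
        has_derivative_compose[OF DF DA] D2] by (simp add: DF_def)
  then show "P w differentiable (at z)" unfolding differentiable_def by blast
  have fr: "frechet_derivative (P w) (at z) = (\<lambda>u. DA (DF w) (DF u) + A (F z) (D2 w u))" for w
    using frechet_derivative_at[OF P] by simp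
  interpret lam: bounded_linear "A (F z)"
    using linear_imp_bounded_linear_finite_span[OF fin lin[OF S(2)]] .
  \<comment> \<open>Freezing the functional at F z makes the second derivative of F real-valued, so
    scalar symmetry applies to exactly the terms that must cancel.\<close>
  let ?h = "\<lambda>y. A (F z) (F y)"
  have h: "(?h has_derivative (\<lambda>u. A (F z) (frechet_derivative F (at y) u))) (at y)" if "y \<in> S" for y
    using lam.has_derivative[OF F[OF that, unfolded frechet_derivative_works]] .
  have hf: "frechet_derivative ?h (at y) = (\<lambda>u. A (F z) (frechet_derivative F (at y) u))" if "y \<in> S" for y
    using frechet_derivative_at[OF h[OF that]] by simp
  have "((\<lambda>y. frechet_derivative ?h (at y) w) has_derivative (\<lambda>u. A (F z) (D2 w u))) (at z)" for w
    using has_derivative_transform_within_open[OF lam.has_derivative[OF D2] S, of w] hf by simp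
  then have "A (F z) (D2 w u) = A (F z) (D2 u w)"
    using second_derivative_symmetric[OF S, of ?h w _ u] h unfolding differentiable_def by blast
  then show "frechet_derivative (P w) (at z) u - frechet_derivative (P u) (at z) w
      = frechet_derivative (\<lambda>y. A y (DF w)) (at (F z)) (DF u)
      - frechet_derivative (\<lambda>y. A y (DF u)) (at (F z)) (DF w)"
    unfolding fr DA_def by simp
qed


section \<open>Smooth maps\<close>

text \<open>The two functions have the same derivatives at x, if any, so the choice inside
  \<open>frechet_derivative\<close> agrees even where nothing is differentiable.\<close>

lemma frechet_derivative_cong_open:
  assumes "open S" "x \<in> S" "\<And>y. y \<in> S \<Longrightarrow> f y = g y"
  shows "frechet_derivative f (at x) = frechet_derivative g (at x)"
proof -
  have "(f has_derivative D) (at x) = (g has_derivative D) (at x)" for D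
    using has_derivative_transform_within_open[OF _ assms(1,2), of f D UNIV g]
      has_derivative_transform_within_open[OF _ assms(1,2), of g D UNIV f] assms(3) by auto
  then show ?thesis unfolding frechet_derivative_def by simp
qed

lemma smooth_on_imp_differentiable:
  assumes "smooth_on f S" "x \<in> S"
  shows "f differentiable (at x)"
    and "(\<lambda>y. frechet_derivative f (at y) v) differentiable (at x)"
proof -
  have "Ck_on (Suc (Suc 0)) f S" using assms(1) unfolding smooth_on_def by blast
  then show "f differentiable (at x)" "(\<lambda>y. frechet_derivative f (at y) v) differentiable (at x)"
    using assms(2) by auto
qed

lemma smooth_on_has_derivative:
  assumes "smooth_on f S" "x \<in> S"
  shows "(f has_derivative frechet_derivative f (at x)) (at x)"
  using smooth_on_imp_differentiable(1)[OF assms] frechet_derivative_works by blast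

lemma Ck_on_cong:
  assumes "open S" "\<And>x. x \<in> S \<Longrightarrow> f x = g x" "Ck_on k f S"
  shows "Ck_on k g S"
  using assms(2,3)
proof (induction k arbitrary: f g)
  case 0
  then show ?case using continuous_on_cong[of S S f g] by simp
next
  case (Suc k)
  have d: "(g has_derivative frechet_derivative f (at x)) (at x)" if "x \<in> S" for x
    using has_derivative_transform_within_open[OF _ assms(1) that Suc.prems(1)] Suc.prems(2) that
    by (simp add: frechet_derivative_works)
  then have "frechet_derivative f (at x) = frechet_derivative g (at x)" if "x \<in> S" for x
    using frechet_derivative_at that by blast
  then have "Ck_on k (\<lambda>x. frechet_derivative g (at x) v) S" for v
    using Suc.IH[of "\<lambda>x. frechet_derivative f (at x) v"] Suc.prems(2) by simp
  moreover have "g differentiable (at x)" if "x \<in> S" for x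
    using d[OF that] unfolding differentiable_def by blast
  ultimately show ?case by simp
qed

section \<open>Composition with affine maps and slices of product domains\<close>

lemma has_derivative_compose_affine:
  assumes "bounded_linear l" "(f has_derivative D) (at (a + l x))"
  shows "((\<lambda>x. f (a + l x)) has_derivative (\<lambda>v. D (l v))) (at x)"
proof -
  have "((\<lambda>x. a + l x) has_derivative l) (at x)"
    using bounded_linear.has_derivative[OF assms(1) has_derivative_ident] by (auto intro!: derivative_eq_intros)
  from has_derivative_compose[OF this assms(2)] show ?thesis .
qed

text \<open>The derivative of the composite along v is the derivative of f along the fixed vector l
  v, composed with the same affine map. Hence the induction closes without a higher-order chain
  rule.\<close>

lemma Ck_on_compose_affine:
  fixes l :: "'a::real_normed_vector \<Rightarrow> 'b::real_normed_vector"
  assumes "open S" "bounded_linear l" "Ck_on k f S"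
  shows "Ck_on k (\<lambda>x. f (a + l x)) {x. a + l x \<in> S}"
  using assms(3)
proof (induction k arbitrary: f)
  have cont: "continuous_on UNIV (\<lambda>x. a + l x)"
    using assms(2) by (intro continuous_intros linear_continuous_on)
  case 0
  have "continuous_on {x. a + l x \<in> S} (\<lambda>x. a + l x)"
    using cont continuous_on_subset by blast
  then show ?case
    using 0 by (auto intro: continuous_on_compose2)
next
  have cont: "continuous_on UNIV (\<lambda>x. a + l x)"
    using assms(2) by (intro continuous_intros linear_continuous_on)
  have op: "open {x. a + l x \<in> S}"
    using open_vimage[OF assms(1) cont] by (simp add: vimage_def)
  case (Suc k)
  have d: "((\<lambda>x. f (a + l x)) has_derivative (\<lambda>v. frechet_derivative f (at (a + l x)) (l v))) (at x)"
    if "a + l x \<in> S" for x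
    using Suc.prems that by (intro has_derivative_compose_affine assms(2)) (simp add: frechet_derivative_works)
  have "Ck_on k (\<lambda>x. frechet_derivative (\<lambda>x. f (a + l x)) (at x) v) {x. a + l x \<in> S}" for v
  proof (rule Ck_on_cong[OF op])
    show "Ck_on k (\<lambda>x. frechet_derivative f (at (a + l x)) (l v)) {x. a + l x \<in> S}"
      using Suc.IH[of "\<lambda>y. frechet_derivative f (at y) (l v)"] Suc.prems by simp
    show "frechet_derivative f (at (a + l x)) (l v) = frechet_derivative (\<lambda>x. f (a + l x)) (at x) v"
      if "x \<in> {x. a + l x \<in> S}" for x
      using frechet_derivative_at[OF d[of x]] that by (metis mem_Collect_eq)
  qed
  moreover have "(\<lambda>x. f (a + l x)) differentiable (at x)" if "a + l x \<in> S" for x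
    using d[OF that] unfolding differentiable_def by blast
  ultimately show ?case by simp
qed

lemma smooth_on_cong:
  "\<lbrakk>open S; \<And>x. x \<in> S \<Longrightarrow> f x = g x; smooth_on f S\<rbrakk> \<Longrightarrow> smooth_on g S"
  unfolding smooth_on_def using Ck_on_cong by blast

lemma smooth_on_compose_affine:
  "\<lbrakk>open S; bounded_linear l; smooth_on f S\<rbrakk> \<Longrightarrow> smooth_on (\<lambda>x. f (a + l x)) {x. a + l x \<in> S}"
  unfolding smooth_on_def using Ck_on_compose_affine by blast

lemma bounded_linear_zero_Pair: "bounded_linear (\<lambda>x. (0, x))"
  and bounded_linear_Pair_zero: "bounded_linear (\<lambda>x. (x, 0))"
  by (intro bounded_linear_Pair bounded_linear_zero bounded_linear_ident)+

lemma smooth_on_slice: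
  fixes f :: "'a::real_normed_vector \<times> 'b::real_normed_vector \<Rightarrow> 'c::real_normed_vector"
  assumes "open S" "smooth_on f S"
  shows "smooth_on (\<lambda>x. f (a, x)) {x. (a, x) \<in> S}" "smooth_on (\<lambda>x. f (x, b)) {x. (x, b) \<in> S}"
  using smooth_on_compose_affine[OF assms(1) bounded_linear_zero_Pair assms(2), of "(a, 0)"]
    smooth_on_compose_affine[OF assms(1) bounded_linear_Pair_zero assms(2), of "(0, b)"]
  by simp_all

lemma frechet_derivative_slice:
  assumes "f differentiable (at (a, b))"
  shows "frechet_derivative (\<lambda>x. f (a, x)) (at b) v = frechet_derivative f (at (a, b)) (0, v)"
    and "frechet_derivative (\<lambda>x. f (x, b)) (at a) u = frechet_derivative f (at (a, b)) (u, 0)"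
proof -
  have D: "(f has_derivative frechet_derivative f (at (a, b))) (at (a, b))"
    using assms frechet_derivative_works by blast
  have "((\<lambda>x. f ((a, 0) + (0, x))) has_derivative (\<lambda>v. frechet_derivative f (at (a, b)) (0, v))) (at b)"
    using D by (intro has_derivative_compose_affine[OF bounded_linear_zero_Pair]) simp
  from frechet_derivative_at[OF this, symmetric]
  show "frechet_derivative (\<lambda>x. f (a, x)) (at b) v = frechet_derivative f (at (a, b)) (0, v)"
    by simp
  have "((\<lambda>x. f ((0, b) + (x, 0))) has_derivative (\<lambda>v. frechet_derivative f (at (a, b)) (v, 0))) (at a)"
    using D by (intro has_derivative_compose_affine[OF bounded_linear_Pair_zero]) simp
  from frechet_derivative_at[OF this, symmetric]
  show "frechet_derivative (\<lambda>x. f (x, b)) (at a) u = frechet_derivative f (at (a, b)) (u, 0)"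
    by simp
qed


section \<open>Charts and tangent vectors\<close>

lemma smooth_manifoldD:
  assumes "smooth_manifold M" "c \<in> charts M"
  shows chart_openin: "openin (mtop M) (fst c)"
    and chart_subset: "fst c \<subseteq> points M"
    and chart_inj: "inj_on (snd c) (fst c)"
    and chart_homeomorphic: "homeomorphic_map (subtopology (mtop M) (fst c)) (top_of_set (snd c ` fst c)) (snd c)"
    and chart_open_range: "open (snd c ` fst c)"
proof -
  show 1: "openin (mtop M) (fst c)"
    and 3: "homeomorphic_map (subtopology (mtop M) (fst c)) (top_of_set (snd c ` fst c)) (snd c)"
    and "open (snd c ` fst c)"
    using assms unfolding smooth_manifold_def by blast+
  show 2: "fst c \<subseteq> points M" using 1 by (rule openin_subset)
  show "inj_on (snd c) (fst c)"
    using homeomorphic_imp_injective_map[OF 3] 2 by (simp add: Int_absorb1)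
qed

lemma chart_inv_chart [simp]:
  assumes "smooth_manifold M" "c \<in> charts M" "p \<in> fst c"
  shows "chart_inv c (snd c p) = p"
  unfolding chart_inv_def using chart_inj[OF assms(1,2)] assms(3) by (rule inv_into_f_f)

lemma chart_chart_inv [simp]: "x \<in> snd c ` fst c \<Longrightarrow> snd c (chart_inv c x) = x"
  unfolding chart_inv_def by (rule f_inv_into_f)

lemma chart_inv_in [simp]: "x \<in> snd c ` fst c \<Longrightarrow> chart_inv c x \<in> fst c"
  unfolding chart_inv_def by (rule inv_into_into)

lemma chart_image_open:
  assumes "smooth_manifold M" "c \<in> charts M" "openin (mtop M) U" "U \<subseteq> fst c"
  shows "open (snd c ` U)"
proof -
  have "openin (subtopology (mtop M) (fst c)) U"
    using assms(3,4) openin_open_subtopology[OF chart_openin[OF assms(1,2)]] by blast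
  then have "openin (top_of_set (snd c ` fst c)) (snd c ` U)"
    using homeomorphic_imp_open_map[OF chart_homeomorphic[OF assms(1,2)]] by (simp add: open_map_def)
  then show ?thesis
    using chart_open_range[OF assms(1,2)] openin_open_eq by blast
qed

lemma continuous_map_chart_inv:
  assumes "smooth_manifold M" "c \<in> charts M"
  shows "continuous_map (top_of_set (snd c ` fst c)) (mtop M) (chart_inv c)"
proof -
  let ?X = "subtopology (mtop M) (fst c)" and ?Y = "top_of_set (snd c ` fst c)"
  obtain g where g: "homeomorphic_maps ?X ?Y (snd c) g"
    using chart_homeomorphic[OF assms] homeomorphic_map_maps by blast
  have "continuous_map ?Y (mtop M) g"
    using g by (simp add: homeomorphic_maps_def continuous_map_in_subtopology)
  moreover have "g x = chart_inv c x" if "x \<in> topspace ?Y" for x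
  proof -
    have gx: "g x \<in> fst c" "snd c (g x) = x"
      using g that chart_subset[OF assms]
      by (auto simp: homeomorphic_maps_def continuous_map_def Pi_iff)
    show ?thesis using chart_inv_chart[OF assms gx(1)] gx(2) by simp
  qed
  ultimately show ?thesis by (rule continuous_map_eq)
qed

lemma chart_preimage_open:
  assumes "smooth_manifold M" "c \<in> charts M" "continuous_map (mtop M) T F" "openin T V"
  shows "open (snd c ` {p \<in> fst c. F p \<in> V})"
proof (rule chart_image_open[OF assms(1,2)])
  show "openin (mtop M) {p \<in> fst c. F p \<in> V}"
    by (rule openin_continuous_map_preimage_gen[OF assms(3) chart_openin[OF assms(1,2)] assms(4)])
qed auto

lemma charts_atD: "c \<in> charts_at M p \<Longrightarrow> c \<in> charts M" "c \<in> charts_at M p \<Longrightarrow> p \<in> fst c"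
  by (simp_all add: charts_at_def)

lemma some_chart_in:
  assumes "smooth_manifold M" "p \<in> points M"
  shows "some_chart M p \<in> charts_at M p"
proof -
  have "\<exists>c. c \<in> charts_at M p"
    using assms unfolding smooth_manifold_def charts_at_def by blast
  then show ?thesis unfolding some_chart_def by (rule someI_ex)
qed

text \<open>Inserting \<open>chart_inv d \<circ> snd d\<close> after F changes nothing where F lands
  in the domain of d, and continuity of F makes that an open condition. With h a chart, a chart
  after a further map, or a real function, this yields the chart independence and functoriality used
  below.\<close>

lemma chart_chain:
  assumes M: "smooth_manifold M" and N: "smooth_manifold N"
    and F: "continuous_map (mtop M) (mtop N) F"
    and c: "c \<in> charts_at M p" and d: "d \<in> charts_at N (F p)"
    and D: "((snd d \<circ> F \<circ> chart_inv c) has_derivative D) (at (snd c p))"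
    and D': "((h \<circ> chart_inv d) has_derivative D') (at (snd d (F p)))"
  shows "((h \<circ> F \<circ> chart_inv c) has_derivative (\<lambda>v. D' (D v))) (at (snd c p))"
proof -
  note cM = charts_atD[OF c] and dN = charts_atD[OF d]
  let ?U = "snd c ` {q \<in> fst c. F q \<in> fst d}"
  have "(h \<circ> chart_inv d has_derivative D') (at ((snd d \<circ> F \<circ> chart_inv c) (snd c p)))"
    using D' M cM by simp
  from has_derivative_compose[OF D this]
  have "((\<lambda>x. (h \<circ> chart_inv d) ((snd d \<circ> F \<circ> chart_inv c) x)) has_derivative (\<lambda>v. D' (D v))) (at (snd c p))" .
  then show ?thesis
  proof (rule has_derivative_transform_within_open)
    show "open ?U" using M cM(1) F chart_openin[OF N dN(1)] by (rule chart_preimage_open)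
    show "snd c p \<in> ?U" using cM dN by auto
    show "(h \<circ> chart_inv d) ((snd d \<circ> F \<circ> chart_inv c) x) = (h \<circ> F \<circ> chart_inv c) x" if "x \<in> ?U" for x
      using that M N cM(1) dN(1) by auto
  qed
qed

lemma smooth_map_has_derivative:
  assumes "smooth_map M N F" "c \<in> charts_at M p" "d \<in> charts_at N (F p)"
  shows "((snd d \<circ> F \<circ> chart_inv c) has_derivative
     frechet_derivative (snd d \<circ> F \<circ> chart_inv c) (at (snd c p))) (at (snd c p))"
  using assms unfolding smooth_map_def charts_at_def
  by (intro smooth_on_has_derivative[where S = "snd c ` {p \<in> fst c. F p \<in> fst d}"]) auto

lemma transition_has_derivative:
  assumes "smooth_manifold M" "c \<in> charts_at M p" "d \<in> charts_at M p"
  shows "((snd d \<circ> chart_inv c) has_derivative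
     frechet_derivative (snd d \<circ> chart_inv c) (at (snd c p))) (at (snd c p))"
  using assms unfolding smooth_manifold_def charts_at_def
  by (intro smooth_on_has_derivative[where S = "snd c ` (fst c \<inter> fst d)"]) auto

lemma transition_chain:
  assumes M: "smooth_manifold M" and c: "c \<in> charts_at M p" and d: "d \<in> charts_at M p"
    and h: "((h \<circ> chart_inv d) has_derivative D) (at (snd d p))"
  shows "((h \<circ> chart_inv c) has_derivative
     (\<lambda>v. D (frechet_derivative (snd d \<circ> chart_inv c) (at (snd c p)) v))) (at (snd c p))"
  using chart_chain[OF M M continuous_map_id c, of d "frechet_derivative (snd d \<circ> chart_inv c) (at (snd c p))" h D]
    transition_has_derivative[OF M c d] d h by simp

lemma coord_vec_self:
  assumes M: "smooth_manifold M" and c: "c \<in> charts_at M p"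
  shows "coord_vec M c p e c = e"
proof -
  note cM = charts_atD[OF c]
  have "((\<lambda>x. x) has_derivative (\<lambda>x. x)) (at (snd c p))" by (rule has_derivative_ident)
  then have "((snd c \<circ> chart_inv c) has_derivative (\<lambda>x. x)) (at (snd c p))"
    by (rule has_derivative_transform_within_open[OF _ chart_open_range[OF M cM(1)]]) (use cM in auto)
  from frechet_derivative_at[OF this] show ?thesis
    using c by (simp add: coord_vec_def fun_eq_iff)
qed

text \<open>The compatibility between charts is the chain rule for transition maps.\<close>

lemma coord_vec_in_tangent_space:
  assumes M: "smooth_manifold M" and c: "c \<in> charts_at M p"
  shows "coord_vec M c p e \<in> tangent_space M p"
  unfolding tangent_space_def
proof (intro CollectI conjI ballI allI impI)
  show "coord_vec M c p e d = 0" if "d \<notin> charts_at M p" for d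
    using that by (simp add: coord_vec_def)
  fix d d' assume d: "d \<in> charts_at M p" "d' \<in> charts_at M p"
  from frechet_derivative_at[OF transition_chain[OF M c d(1) transition_has_derivative[OF M d]]]
  show "coord_vec M c p e d'
    = frechet_derivative (snd d' \<circ> chart_inv d) (at (snd d p)) (coord_vec M c p e d)"
    using d by (simp add: coord_vec_def fun_eq_iff)
qed

lemma tangent_eq_coord_vec:
  assumes "v \<in> tangent_space M p" "c \<in> charts_at M p"
  shows "v = coord_vec M c p (v c)"
proof
  fix d
  show "v d = coord_vec M c p (v c) d"
  proof (cases "d \<in> charts_at M p")
    case True
    then have "v d = frechet_derivative (snd d \<circ> chart_inv c) (at (snd c p)) (v c)"
      using assms unfolding tangent_space_def by blast
    then show ?thesis unfolding coord_vec_def using True by simp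
  next
    case False
    then have "v d = 0" using assms(1) unfolding tangent_space_def by blast
    then show ?thesis unfolding coord_vec_def using False by simp
  qed
qed

lemma coord_vec_lincomb:
  assumes M: "smooth_manifold M" and c: "c \<in> charts_at M p"
  shows "coord_vec M c p (a *\<^sub>R u + b *\<^sub>R w) = (\<lambda>d. a *\<^sub>R coord_vec M c p u d + b *\<^sub>R coord_vec M c p w d)"
proof
  fix d
  show "coord_vec M c p (a *\<^sub>R u + b *\<^sub>R w) d = a *\<^sub>R coord_vec M c p u d + b *\<^sub>R coord_vec M c p w d"
  proof (cases "d \<in> charts_at M p")
    case True
    interpret D: bounded_linear "frechet_derivative (snd d \<circ> chart_inv c) (at (snd c p))"
      by (rule has_derivative_bounded_linear[OF transition_has_derivative[OF M c True]])
    show ?thesis using True by (simp add: coord_vec_def D.add D.scaleR)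
  qed (simp add: coord_vec_def)
qed

lemma tangent_space_lincomb:
  assumes M: "smooth_manifold M" and p: "p \<in> points M"
    and v: "v \<in> tangent_space M p" and w: "w \<in> tangent_space M p"
  shows "(\<lambda>c. a *\<^sub>R v c + b *\<^sub>R w c) \<in> tangent_space M p"
proof -
  let ?c = "some_chart M p"
  have c: "?c \<in> charts_at M p" using some_chart_in[OF M p] .
  have "(\<lambda>c. a *\<^sub>R v c + b *\<^sub>R w c) = coord_vec M ?c p (a *\<^sub>R v ?c + b *\<^sub>R w ?c)"
    using tangent_eq_coord_vec[OF v c] tangent_eq_coord_vec[OF w c] coord_vec_lincomb[OF M c] by simp
  then show ?thesis using coord_vec_in_tangent_space[OF M c] by simp
qed


section \<open>Tangent maps\<close>

text \<open>Frees \<open>tangent_map\<close> from \<open>some_chart\<close>: compatibility of v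
  absorbs the change of chart at p.\<close>

lemma tangent_map_apply:
  assumes M: "smooth_manifold M" and F: "smooth_map M N F"
    and v: "v \<in> tangent_space M p" and c: "c \<in> charts_at M p" and d: "d \<in> charts_at N (F p)"
  shows "tangent_map M N F p v d = frechet_derivative (snd d \<circ> F \<circ> chart_inv c) (at (snd c p)) (v c)"
proof -
  let ?s = "some_chart M p"
  have "p \<in> points M" using chart_subset[OF M charts_atD(1)[OF c]] charts_atD(2)[OF c] by blast
  then have s: "?s \<in> charts_at M p" by (rule some_chart_in[OF M])
  have "v ?s = frechet_derivative (snd ?s \<circ> chart_inv c) (at (snd c p)) (v c)"
    using v s c unfolding tangent_space_def by blast
  with frechet_derivative_at[OF transition_chain[OF M c s smooth_map_has_derivative[OF F s d]]]
  show ?thesis using d by (simp add: tangent_map_def Let_def fun_eq_iff)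
qed

text \<open>\<open>tangent_map\<close> reads v in \<open>some_chart M p\<close> alone, so any family
  v is sent to a compatible one.\<close>

lemma tangent_map_in_tangent_space:
  assumes M: "smooth_manifold M" and N: "smooth_manifold N" and F: "smooth_map M N F"
    and p: "p \<in> points M"
  shows "tangent_map M N F p v \<in> tangent_space N (F p)"
  unfolding tangent_space_def
proof (intro CollectI conjI ballI allI impI)
  let ?c = "some_chart M p"
  have c: "?c \<in> charts_at M p" using some_chart_in[OF M p] .
  have cont: "continuous_map (mtop M) (mtop N) F" using F by (simp add: smooth_map_def)
  show "tangent_map M N F p v d = 0" if "d \<notin> charts_at N (F p)" for d
    using that by (simp add: tangent_map_def)
  fix d d' assume d: "d \<in> charts_at N (F p)" "d' \<in> charts_at N (F p)"
  from frechet_derivative_at[OF chart_chain[OF M N cont c d(1) smooth_map_has_derivative[OF F c d(1)]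
        transition_has_derivative[OF N d]]]
  show "tangent_map M N F p v d'
    = frechet_derivative (snd d' \<circ> chart_inv d) (at (snd d (F p))) (tangent_map M N F p v d)"
    using d by (simp add: tangent_map_def Let_def fun_eq_iff)
qed

lemma tangent_map_compose:
  assumes M: "smooth_manifold M" and N: "smooth_manifold N"
    and F: "smooth_map M N F" and F': "smooth_map N K F'" and p: "p \<in> points M"
  shows "tangent_map N K F' (F p) (tangent_map M N F p v) = tangent_map M K (F' \<circ> F) p v"
proof
  fix e
  let ?c = "some_chart M p" and ?d = "some_chart N (F p)"
  have cont: "continuous_map (mtop M) (mtop N) F" using F by (simp add: smooth_map_def)
  then have Fp: "F p \<in> points N" using p by (auto simp: continuous_map_def)
  have c: "?c \<in> charts_at M p" and d: "?d \<in> charts_at N (F p)"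
    by (rule some_chart_in[OF M p], rule some_chart_in[OF N Fp])
  show "tangent_map N K F' (F p) (tangent_map M N F p v) e = tangent_map M K (F' \<circ> F) p v e"
  proof (cases "e \<in> charts_at K (F' (F p))")
    case True
    from frechet_derivative_at[OF chart_chain[OF M N cont c d smooth_map_has_derivative[OF F c d]
          smooth_map_has_derivative[OF F' d True]]]
    show ?thesis using d True by (simp add: tangent_map_def Let_def o_def fun_eq_iff)
  qed (simp add: tangent_map_def)
qed

text \<open>Meant for \<open>\<Phi> g \<circ> \<Phi> (inv g)\<close>, which is the identity on the
  points of M but not as a function on the whole type.\<close>

lemma tangent_map_identity:
  assumes M: "smooth_manifold M" and F: "\<And>q. q \<in> points M \<Longrightarrow> F q = q"
    and p: "p \<in> points M" and v: "v \<in> tangent_space M p"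
  shows "tangent_map M M F p v = v"
proof
  fix d
  let ?c = "some_chart M p"
  have c: "?c \<in> charts_at M p" using some_chart_in[OF M p] .
  note cM = charts_atD[OF c]
  show "tangent_map M M F p v d = v d"
  proof (cases "d \<in> charts_at M p")
    case True
    have "frechet_derivative (snd d \<circ> chart_inv ?c) (at (snd ?c p))
        = frechet_derivative (snd d \<circ> F \<circ> chart_inv ?c) (at (snd ?c p))"
    proof (rule frechet_derivative_cong_open[OF chart_open_range[OF M cM(1)]])
      show "snd ?c p \<in> snd ?c ` fst ?c" using cM by blast
      show "(snd d \<circ> chart_inv ?c) x = (snd d \<circ> F \<circ> chart_inv ?c) x" if "x \<in> snd ?c ` fst ?c" for x
        using chart_inv_in[OF that] F chart_subset[OF M cM(1)] by auto
    qed
    moreover have "v d = frechet_derivative (snd d \<circ> chart_inv ?c) (at (snd ?c p)) (v ?c)"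
      using v c True unfolding tangent_space_def by blast
    ultimately show ?thesis
      unfolding tangent_map_def Let_def F[OF p] using True by simp
  next
    case False
    then have "v d = 0" using v unfolding tangent_space_def by blast
    then show ?thesis unfolding tangent_map_def F[OF p] using False by simp
  qed
qed

lemma smooth_fun_has_derivative:
  assumes "smooth_fun M h" "c \<in> charts_at M p"
  shows "((h \<circ> chart_inv c) has_derivative frechet_derivative (h \<circ> chart_inv c) (at (snd c p))) (at (snd c p))"
  using assms unfolding smooth_fun_def charts_at_def
  by (intro smooth_on_has_derivative[where S = "snd c ` fst c"]) auto

lemma differential_tangent_map:
  assumes M: "smooth_manifold M" and N: "smooth_manifold N"
    and F: "smooth_map M N F" and h: "smooth_fun N h" and p: "p \<in> points M"
  shows "differential N h (F p) (tangent_map M N F p v) = differential M (h \<circ> F) p v"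
proof -
  let ?c = "some_chart M p" and ?d = "some_chart N (F p)"
  have cont: "continuous_map (mtop M) (mtop N) F" using F by (simp add: smooth_map_def)
  then have Fp: "F p \<in> points N" using p by (auto simp: continuous_map_def)
  have c: "?c \<in> charts_at M p" and d: "?d \<in> charts_at N (F p)"
    by (rule some_chart_in[OF M p], rule some_chart_in[OF N Fp])
  from frechet_derivative_at[OF chart_chain[OF M N cont c d smooth_map_has_derivative[OF F c d]
        smooth_fun_has_derivative[OF h d]]]
  show ?thesis using d by (simp add: differential_def tangent_map_def Let_def fun_eq_iff)
qed

lemma differential_cong:
  assumes M: "smooth_manifold M" and p: "p \<in> points M"
    and eq: "\<And>q. q \<in> points M \<Longrightarrow> h q = h' q"
  shows "differential M h p = differential M h' p"
proof -
  let ?c = "some_chart M p"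
  have c: "?c \<in> charts_at M p" using some_chart_in[OF M p] .
  note cM = charts_atD[OF c]
  have "frechet_derivative (h \<circ> chart_inv ?c) (at (snd ?c p))
      = frechet_derivative (h' \<circ> chart_inv ?c) (at (snd ?c p))"
  proof (rule frechet_derivative_cong_open[OF chart_open_range[OF M cM(1)]])
    show "snd ?c p \<in> snd ?c ` fst ?c" using cM by blast
    show "(h \<circ> chart_inv ?c) x = (h' \<circ> chart_inv ?c) x" if "x \<in> snd ?c ` fst ?c" for x
      using chart_inv_in[OF that] eq chart_subset[OF M cM(1)] by auto
  qed
  then show ?thesis by (simp add: differential_def fun_eq_iff)
qed


section \<open>Pullback of one-forms\<close>

lemma one_form_lincomb:
  assumes "smooth_one_form M \<theta>" "p \<in> points M" "v \<in> tangent_space M p" "w \<in> tangent_space M p"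
  shows "\<theta> p (\<lambda>c. a *\<^sub>R v c + b *\<^sub>R w c) = a * \<theta> p v + b * \<theta> p w"
  using assms unfolding smooth_one_form_def cotangent_space_def by blast

lemma form_coord_chart:
  assumes "smooth_manifold M" "c \<in> charts_at M p" "v \<in> tangent_space M p"
  shows "form_coord M \<theta> c (v c) (snd c p) = \<theta> p v"
  using chart_inv_chart[OF assms(1) charts_atD[OF assms(2)]] tangent_eq_coord_vec[OF assms(3,2), symmetric]
  by (simp add: form_coord_def)

lemma linear_form_coord:
  assumes M: "smooth_manifold M" and \<theta>: "smooth_one_form M \<theta>"
    and c: "c \<in> charts M" and x: "x \<in> snd c ` fst c"
  shows "linear (\<lambda>e. form_coord M \<theta> c e x)"
proof -
  let ?p = "chart_inv c x"
  have cp: "c \<in> charts_at M ?p" using c chart_inv_in[OF x] by (simp add: charts_at_def)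
  have p: "?p \<in> points M" using chart_subset[OF M c] chart_inv_in[OF x] by blast
  have lin: "form_coord M \<theta> c (a *\<^sub>R u + b *\<^sub>R w) x = a * form_coord M \<theta> c u x + b * form_coord M \<theta> c w x"
    for a b u w
    unfolding form_coord_def coord_vec_lincomb[OF M cp]
    by (intro one_form_lincomb[OF \<theta> p] coord_vec_in_tangent_space[OF M cp])
  show ?thesis
    using lin[of 1 _ 1] lin[of _ _ 0] by (intro linearI) simp_all
qed

lemma form_coord_differentiable:
  assumes "smooth_one_form M \<theta>" "c \<in> charts M" "x \<in> snd c ` fst c"
  shows "form_coord M \<theta> c e differentiable (at x)"
  using assms smooth_on_imp_differentiable(1) unfolding smooth_one_form_def by blast

text \<open>The coordinate form of F^* \<theta> = \<theta>. The left side has the shape of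
  \<open>P\<close> in \<open>pullback_derivative\<close>, so the identity can be
  differentiated.\<close>

lemma form_coord_pullback:
  assumes M: "smooth_manifold M" and F: "smooth_map M M F"
    and inv: "\<And>p v. p \<in> points M \<Longrightarrow> v \<in> tangent_space M p \<Longrightarrow> \<theta> (F p) (tangent_map M M F p v) = \<theta> p v"
    and c: "c \<in> charts M" and d: "d \<in> charts M"
    and x: "x \<in> snd c ` fst c" "F (chart_inv c x) \<in> fst d"
  shows "form_coord M \<theta> d (frechet_derivative (snd d \<circ> F \<circ> chart_inv c) (at x) e)
      ((snd d \<circ> F \<circ> chart_inv c) x) = form_coord M \<theta> c e x"
proof -
  let ?p = "chart_inv c x"
  let ?v = "coord_vec M c ?p e"
  have cp: "c \<in> charts_at M ?p" using c chart_inv_in[OF x(1)] by (simp add: charts_at_def)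
  have dp: "d \<in> charts_at M (F ?p)" using d x(2) by (simp add: charts_at_def)
  have p: "?p \<in> points M" using chart_subset[OF M c] chart_inv_in[OF x(1)] by blast
  have v: "?v \<in> tangent_space M ?p" by (rule coord_vec_in_tangent_space[OF M cp])
  have "form_coord M \<theta> d (tangent_map M M F ?p ?v d) (snd d (F ?p)) = \<theta> ?p ?v"
    using form_coord_chart[OF M dp tangent_map_in_tangent_space[OF M M F p]] inv[OF p v] by simp
  moreover have "tangent_map M M F ?p ?v d = frechet_derivative (snd d \<circ> F \<circ> chart_inv c) (at x) e"
    using tangent_map_apply[OF M F v cp dp] coord_vec_self[OF M cp] x(1) by simp
  ultimately show ?thesis by (simp add: form_coord_def)
qed

text \<open>Near p the pulled-back coefficients are those of \<theta> itself, so their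
  antisymmetrised derivatives are d\<theta> at p, while \<open>pullback_derivative\<close> computes
  them as d\<theta> at F p.\<close>

lemma ext_deriv_pullback:
  assumes M: "smooth_manifold M" and \<theta>: "smooth_one_form M \<theta>" and F: "smooth_map M M F"
    and inv: "\<And>p v. p \<in> points M \<Longrightarrow> v \<in> tangent_space M p \<Longrightarrow> \<theta> (F p) (tangent_map M M F p v) = \<theta> p v"
    and p: "p \<in> points M"
  shows "ext_deriv M \<theta> (F p) (tangent_map M M F p v) (tangent_map M M F p w) = ext_deriv M \<theta> p v w"
proof -
  let ?c = "some_chart M p" and ?d = "some_chart M (F p)"
  have cont: "continuous_map (mtop M) (mtop M) F" using F by (simp add: smooth_map_def)
  then have Fp: "F p \<in> points M" using p by (auto simp: continuous_map_def)
  have c: "?c \<in> charts_at M p" and d: "?d \<in> charts_at M (F p)"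
    by (rule some_chart_in[OF M p], rule some_chart_in[OF M Fp])
  note cM = charts_atD[OF c] and dM = charts_atD[OF d]
  let ?x = "snd ?c p" and ?f = "snd ?d \<circ> F \<circ> chart_inv ?c"
  let ?S = "snd ?c ` {q \<in> fst ?c. F q \<in> fst ?d}"
  have op: "open ?S" by (rule chart_preimage_open[OF M cM(1) cont chart_openin[OF M dM(1)]])
  have x: "?x \<in> ?S" using cM dM by auto
  have S: "y \<in> snd ?c ` fst ?c" "F (chart_inv ?c y) \<in> fst ?d" if "y \<in> ?S" for y
    using that M cM(1) by auto
  have fx: "?f ?x = snd ?d (F p)" using M cM by simp
  have sm: "smooth_on ?f ?S" using F cM(1) dM(1) unfolding smooth_map_def by blast
  obtain B :: "'b set" where B: "finite B" "span B = UNIV"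
    using M unfolding smooth_manifold_def by blast
  have lin: "linear (\<lambda>e. form_coord M \<theta> ?d e (?f y))" if "y \<in> ?S" for y
    using S[OF that] by (intro linear_form_coord[OF M \<theta> dM(1)]) simp
  have dif: "(\<lambda>y. form_coord M \<theta> ?d e y) differentiable (at (?f ?x))" for e
    unfolding fx using form_coord_differentiable[OF \<theta> dM(1)] dM(2) by blast
  let ?P = "\<lambda>e y. form_coord M \<theta> ?d (frechet_derivative ?f (at y) e) (?f y)"
  have P: "frechet_derivative (?P e) (at ?x) = frechet_derivative (form_coord M \<theta> ?c e) (at ?x)" for e
  proof (rule frechet_derivative_cong_open[OF op x])
    show "?P e y = form_coord M \<theta> ?c e y" if "y \<in> ?S" for y
      by (intro form_coord_pullback M F inv cM(1) dM(1) S that)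
  qed
  have "frechet_derivative (?P w) (at ?x) u - frechet_derivative (?P u) (at ?x) w
      = frechet_derivative (form_coord M \<theta> ?d (frechet_derivative ?f (at ?x) w)) (at (?f ?x)) (frechet_derivative ?f (at ?x) u)
      - frechet_derivative (form_coord M \<theta> ?d (frechet_derivative ?f (at ?x) u)) (at (?f ?x)) (frechet_derivative ?f (at ?x) w)"
    for u w
    by (rule pullback_derivative(2)[where A = "\<lambda>y e. form_coord M \<theta> ?d e y", OF B op x
          smooth_on_imp_differentiable[OF sm] lin dif]) (use x in auto)
  then show ?thesis
    using d unfolding P fx by (simp add: ext_deriv_def tangent_map_def Let_def)
qed

text \<open>The second slot enters once as a direction of differentiation and once as the fixed
  argument of the form. For the latter, linearity of the form is used at all points of the
  chart.\<close>

lemma ext_deriv_diff_right: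
  assumes M: "smooth_manifold M" and \<theta>: "smooth_one_form M \<theta>" and p: "p \<in> points M"
  shows "ext_deriv M \<theta> p u (\<lambda>c. v c - w c) = ext_deriv M \<theta> p u v - ext_deriv M \<theta> p u w"
proof -
  let ?c = "some_chart M p"
  let ?x = "snd ?c p" and ?S = "snd ?c ` fst ?c"
  have c: "?c \<in> charts_at M p" using some_chart_in[OF M p] .
  note cM = charts_atD[OF c]
  have x: "?x \<in> ?S" using cM by blast
  have D: "(form_coord M \<theta> ?c e has_derivative frechet_derivative (form_coord M \<theta> ?c e) (at ?x)) (at ?x)" for e
    using form_coord_differentiable[OF \<theta> cM(1) x] frechet_derivative_works by blast
  have "((\<lambda>y. form_coord M \<theta> ?c (v ?c) y - form_coord M \<theta> ?c (w ?c) y) has_derivative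
      (\<lambda>h. frechet_derivative (form_coord M \<theta> ?c (v ?c)) (at ?x) h
         - frechet_derivative (form_coord M \<theta> ?c (w ?c)) (at ?x) h)) (at ?x)"
    by (intro has_derivative_diff D)
  then have "(form_coord M \<theta> ?c (v ?c - w ?c) has_derivative
      (\<lambda>h. frechet_derivative (form_coord M \<theta> ?c (v ?c)) (at ?x) h
         - frechet_derivative (form_coord M \<theta> ?c (w ?c)) (at ?x) h)) (at ?x)"
  proof (rule has_derivative_transform_within_open[OF _ chart_open_range[OF M cM(1)] x])
    show "form_coord M \<theta> ?c (v ?c) y - form_coord M \<theta> ?c (w ?c) y = form_coord M \<theta> ?c (v ?c - w ?c) y"
      if "y \<in> ?S" for y
      using linear_diff[OF linear_form_coord[OF M \<theta> cM(1) that]] by metis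
  qed
  from frechet_derivative_at[OF this, symmetric]
  show ?thesis
    using bounded_linear.linear[OF has_derivative_bounded_linear[OF D[of "u ?c"]]]
    by (simp add: ext_deriv_def Let_def linear_diff)
qed

lemma ext_deriv_swap: "ext_deriv M \<theta> p v w = - ext_deriv M \<theta> p w v"
  by (simp add: ext_deriv_def Let_def)

lemma exact_symplectic_manifoldD:
  assumes "exact_symplectic_manifold M \<theta>"
  shows "smooth_manifold M" "smooth_one_form M \<theta>"
  using assms by (simp_all add: exact_symplectic_manifold_def)

text \<open>Nondegeneracy is stated for the first slot, but \<open>interior_product\<close> puts the
  vector field into the second; antisymmetry carries one over to the other.\<close>

lemma symp_form_eqI:
  assumes sym: "exact_symplectic_manifold M \<theta>" and p: "p \<in> points M"
    and v: "v \<in> tangent_space M p" and w: "w \<in> tangent_space M p"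
    and eq: "\<And>u. u \<in> tangent_space M p \<Longrightarrow> symp_form M \<theta> p u v = symp_form M \<theta> p u w"
  shows "v = w"
proof -
  note M = exact_symplectic_manifoldD[OF sym]
  let ?z = "\<lambda>c. v c - w c"
  have z: "?z \<in> tangent_space M p"
    using tangent_space_lincomb[OF M(1) p v w, of 1 "- 1"] by simp
  have "symp_form M \<theta> p ?z u = 0" if "u \<in> tangent_space M p" for u
    using eq[OF that] ext_deriv_diff_right[OF M p, of u v w] ext_deriv_swap[of M \<theta> p ?z u]
    by (simp add: symp_form_def)
  then have "?z = (\<lambda>_. 0)"
    using sym p z unfolding exact_symplectic_manifold_def by blast
  then show ?thesis by (simp add: fun_eq_iff)
qed


section \<open>Partial maps of a smooth map on a product\<close>

lemma prod_chart:
  assumes "smooth_manifold L" "smooth_manifold M" "c0 \<in> charts L" "c \<in> charts M"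
  shows "(fst c0 \<times> fst c, map_prod (snd c0) (snd c)) \<in> charts (prod_mfd L M)"
    and "a \<in> snd c0 ` fst c0 \<Longrightarrow> x \<in> snd c ` fst c \<Longrightarrow>
      chart_inv (fst c0 \<times> fst c, map_prod (snd c0) (snd c)) (a, x) = (chart_inv c0 a, chart_inv c x)"
proof -
  show "(fst c0 \<times> fst c, map_prod (snd c0) (snd c)) \<in> charts (prod_mfd L M)"
    unfolding prod_mfd_def mfd.simps by (intro CollectI exI[of _ c0] exI[of _ c] conjI refl assms(3,4))
  assume ax: "a \<in> snd c0 ` fst c0" "x \<in> snd c ` fst c"
  have "inj_on (map_prod (snd c0) (snd c)) (fst c0 \<times> fst c)"
    using chart_inj[OF assms(1,3)] chart_inj[OF assms(2,4)] by (rule map_prod_inj_on)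
  moreover have "(chart_inv c0 a, chart_inv c x) \<in> fst c0 \<times> fst c"
    using chart_inv_in[OF ax(1)] chart_inv_in[OF ax(2)] by blast
  ultimately have "chart_inv (fst c0 \<times> fst c, map_prod (snd c0) (snd c))
      (map_prod (snd c0) (snd c) (chart_inv c0 a, chart_inv c x)) = (chart_inv c0 a, chart_inv c x)"
    unfolding chart_inv_def[of "(_, _)"] fst_conv snd_conv by (rule inv_into_f_f)
  then show "chart_inv (fst c0 \<times> fst c, map_prod (snd c0) (snd c)) (a, x) = (chart_inv c0 a, chart_inv c x)"
    unfolding map_prod_simp chart_chart_inv[OF ax(1)] chart_chart_inv[OF ax(2)] .
qed

text \<open>Turns smoothness on the product manifold into smoothness of an explicit function of two
  coordinates on an open set, ready for slicing.\<close>

lemma smooth_prod_map_local: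
  assumes L: "smooth_manifold L" and M: "smooth_manifold M" and N: "smooth_manifold N"
    and \<Phi>: "smooth_map (prod_mfd L M) N (\<lambda>(g, p). \<Phi> g p)"
    and c0: "c0 \<in> charts L" and c: "c \<in> charts M" and d: "d \<in> charts N"
  defines "S \<equiv> {(a, x). a \<in> snd c0 ` fst c0 \<and> x \<in> snd c ` fst c \<and> \<Phi> (chart_inv c0 a) (chart_inv c x) \<in> fst d}"
  shows "open S" "smooth_on (\<lambda>(a, x). snd d (\<Phi> (chart_inv c0 a) (chart_inv c x))) S"
proof -
  let ?U = "snd c0 ` fst c0" and ?V = "snd c ` fst c"
  let ?e = "(fst c0 \<times> fst c, map_prod (snd c0) (snd c))"
  let ?f = "\<lambda>(g, p). \<Phi> g p"
  have "continuous_map (prod_topology (top_of_set ?U) (top_of_set ?V)) (prod_topology (mtop L) (mtop M))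
      (\<lambda>(a, x). (chart_inv c0 a, chart_inv c x))"
    using continuous_map_chart_inv[OF L c0] continuous_map_chart_inv[OF M c]
    unfolding continuous_map_prod_top by blast
  from continuous_map_compose[OF this, of "mtop N" ?f]
  have "continuous_map (top_of_set (?U \<times> ?V)) (mtop N)
      (?f \<circ> (\<lambda>(a, x). (chart_inv c0 a, chart_inv c x)))"
    using \<Phi> by (simp add: smooth_map_def prod_mfd_def)
  from openin_continuous_map_preimage[OF this chart_openin[OF N d]]
  have "openin (top_of_set (?U \<times> ?V)) S"
    by (rule back_subst[of "openin _"]) (auto simp: S_def)
  then show op: "open S"
    using chart_open_range[OF L c0] chart_open_range[OF M c] open_Times openin_open_eq by blast
  have dom: "snd ?e ` {q \<in> fst ?e. ?f q \<in> fst d} = S"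
  proof (intro equalityI subsetI)
    fix z assume "z \<in> snd ?e ` {q \<in> fst ?e. ?f q \<in> fst d}"
    then show "z \<in> S" using L M c0 c by (auto simp: S_def)
  next
    fix z assume "z \<in> S"
    then obtain a x where z: "z = (a, x)" "a \<in> ?U" "x \<in> ?V" "\<Phi> (chart_inv c0 a) (chart_inv c x) \<in> fst d"
      by (auto simp: S_def)
    then show "z \<in> snd ?e ` {q \<in> fst ?e. ?f q \<in> fst d}"
      by (intro image_eqI[of _ _ "(chart_inv c0 a, chart_inv c x)"]) simp_all
  qed
  have "smooth_on (snd d \<circ> ?f \<circ> chart_inv ?e) (snd ?e ` {q \<in> fst ?e. ?f q \<in> fst d})"
    using \<Phi> d prod_chart(1)[OF L M c0 c] unfolding smooth_map_def by blast
  then show "smooth_on (\<lambda>(a, x). snd d (\<Phi> (chart_inv c0 a) (chart_inv c x))) S"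
    unfolding dom
    by (rule smooth_on_cong[OF op, rotated]) (auto simp: S_def prod_chart(2)[OF L M c0 c])
qed

lemma smooth_map_partial:
  assumes L: "smooth_manifold L" and M: "smooth_manifold M" and N: "smooth_manifold N"
    and \<Phi>: "smooth_map (prod_mfd L M) N (\<lambda>(g, p). \<Phi> g p)"
  shows "g \<in> points L \<Longrightarrow> smooth_map M N (\<Phi> g)"
    and "p \<in> points M \<Longrightarrow> smooth_map L N (\<lambda>g. \<Phi> g p)"
proof -
  have cont: "continuous_map (prod_topology (mtop L) (mtop M)) (mtop N) (\<lambda>(g, p). \<Phi> g p)"
    using \<Phi> by (simp add: smooth_map_def prod_mfd_def)
  {
    assume g: "g \<in> points L"
    obtain c0 where c0: "c0 \<in> charts L" "g \<in> fst c0"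
      using some_chart_in[OF L g] charts_atD by metis
    show "smooth_map M N (\<Phi> g)"
      unfolding smooth_map_def
    proof (intro conjI ballI)
      have "continuous_map (mtop M) (prod_topology (mtop L) (mtop M)) (\<lambda>p. (g, p))"
        using g by (intro continuous_map_pairedI) simp_all
      from continuous_map_compose[OF this cont] show con: "continuous_map (mtop M) (mtop N) (\<Phi> g)"
        by (simp add: o_def)
      fix c d assume c: "c \<in> charts M" and d: "d \<in> charts N"
      have op: "open (snd c ` {p \<in> fst c. \<Phi> g p \<in> fst d})"
        by (rule chart_preimage_open[OF M c con chart_openin[OF N d]])
      have "smooth_on (\<lambda>x. snd d (\<Phi> g (chart_inv c x)))
          {x. x \<in> snd c ` fst c \<and> \<Phi> g (chart_inv c x) \<in> fst d}"
        using smooth_on_slice(1)[OF smooth_prod_map_local[OF L M N \<Phi> c0(1) c d], of "snd c0 g"] c0 L by simp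
      moreover have "{x. x \<in> snd c ` fst c \<and> \<Phi> g (chart_inv c x) \<in> fst d} = snd c ` {p \<in> fst c. \<Phi> g p \<in> fst d}"
        using M c by (auto simp: image_iff)
      ultimately show "smooth_on (snd d \<circ> \<Phi> g \<circ> chart_inv c) (snd c ` {p \<in> fst c. \<Phi> g p \<in> fst d})"
        by (simp add: o_def)
    qed
  next
    assume p: "p \<in> points M"
    obtain c where c: "c \<in> charts M" "p \<in> fst c"
      using some_chart_in[OF M p] charts_atD by metis
    show "smooth_map L N (\<lambda>g. \<Phi> g p)"
      unfolding smooth_map_def
    proof (intro conjI ballI)
      have "continuous_map (mtop L) (prod_topology (mtop L) (mtop M)) (\<lambda>g. (g, p))"
        using p by (intro continuous_map_pairedI) simp_all
      from continuous_map_compose[OF this cont] show con: "continuous_map (mtop L) (mtop N) (\<lambda>g. \<Phi> g p)"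
        by (simp add: o_def)
      fix c0 d assume c0: "c0 \<in> charts L" and d: "d \<in> charts N"
      have "smooth_on (\<lambda>a. snd d (\<Phi> (chart_inv c0 a) p))
          {a. a \<in> snd c0 ` fst c0 \<and> \<Phi> (chart_inv c0 a) p \<in> fst d}"
        using smooth_on_slice(2)[OF smooth_prod_map_local[OF L M N \<Phi> c0 c(1) d], of "snd c p"] c M by simp
      moreover have "{a. a \<in> snd c0 ` fst c0 \<and> \<Phi> (chart_inv c0 a) p \<in> fst d} = snd c0 ` {g \<in> fst c0. \<Phi> g p \<in> fst d}"
        using L c0 by (auto simp: image_iff)
      ultimately show "smooth_on (snd d \<circ> (\<lambda>g. \<Phi> g p) \<circ> chart_inv c0) (snd c0 ` {g \<in> fst c0. \<Phi> g p \<in> fst d})"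
        by (simp add: o_def)
    qed
  }
qed


section \<open>Invariance of the conformal Hamiltonian vector field\<close>

lemma group_action_one:
  assumes "group_action G E \<Phi>" "x \<in> E"
  shows "\<Phi> \<one>\<^bsub>G\<^esub> x = x"
  using fun_cong[OF group_action.id_eq_one[OF assms(1)], of x] assms(2) by simp

lemma group_action_inv:
  assumes "group_action G E \<Phi>" "g \<in> carrier G" "x \<in> E"
  shows "\<Phi> g x \<in> E" "\<Phi> (inv\<^bsub>G\<^esub> g) (\<Phi> g x) = x" "\<Phi> g (\<Phi> (inv\<^bsub>G\<^esub> g) x) = x"
proof -
  have G: "group G" using assms(1) by (simp add: group_action_def group_hom_def)
  show "\<Phi> g x \<in> E" using group_action.element_image[OF assms refl] .
  show "\<Phi> (inv\<^bsub>G\<^esub> g) (\<Phi> g x) = x" using group_action.orbit_sym_aux[OF assms refl] .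
  show "\<Phi> g (\<Phi> (inv\<^bsub>G\<^esub> g) x) = x"
    using group_action.orbit_sym_aux[OF assms(1) group.inv_closed[OF G assms(2)] assms(3) refl]
    by (simp add: group.inv_inv[OF G assms(2)])
qed

text \<open>By nondegeneracy it suffices to pair both vectors with an arbitrary u at the point g p;
  moving u back to p reduces both pairings to the defining equation of X there.\<close>

lemma conformal_hamiltonian_invariant:
  assumes lie: "lie_group G L" and sym: "exact_symplectic_manifold M \<theta>"
    and act: "smooth_action G L M \<Phi>" and inv\<theta>: "invariant_one_form G M \<Phi> \<theta>"
    and H: "smooth_fun M H" "invariant_fun G M \<Phi> H" and f: "invariant_fun G M \<Phi> f"
    and X: "conformal_hamiltonian M \<theta> H f X"
  shows "invariant_vector_field G M \<Phi> X"
  unfolding invariant_vector_field_def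
proof (intro ballI)
  fix g p assume g: "g \<in> carrier G" and p: "p \<in> points M"
  note M = exact_symplectic_manifoldD[OF sym]
  have L: "smooth_manifold L" "points L = carrier G" "group G" using lie by (simp_all add: lie_group_def)
  have ga: "group_action G (points M) \<Phi>" and sm: "smooth_map (prod_mfd L M) M (\<lambda>(g, p). \<Phi> g p)"
    using act by (simp_all add: smooth_action_def)
  let ?h = "inv\<^bsub>G\<^esub> g" and ?q = "\<Phi> g p"
  have h: "?h \<in> carrier G" using group.inv_closed[OF L(3) g] .
  have F: "smooth_map M M (\<Phi> g)" and F': "smooth_map M M (\<Phi> ?h)"
    using smooth_map_partial(1)[OF L(1) M(1) M(1) sm] g h L(2) by auto
  have q: "?q \<in> points M" "\<Phi> ?h ?q = p" using group_action_inv[OF ga g p] by simp_all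
  have Xt: "X r \<in> tangent_space M r" if "r \<in> points M" for r
    using X that by (simp add: conformal_hamiltonian_def smooth_vector_field_def)
  have X\<omega>: "symp_form M \<theta> r v (X r) = differential M H r v - f r * \<theta> r v"
    if "r \<in> points M" "v \<in> tangent_space M r" for r v
    using X that by (simp add: conformal_hamiltonian_def interior_product_def)
  have inv: "\<theta> (\<Phi> g r) (tangent_map M M (\<Phi> g) r v) = \<theta> r v"
    if "r \<in> points M" "v \<in> tangent_space M r" for r v
    using inv\<theta> g that by (simp add: invariant_one_form_def)
  show "X ?q = tangent_map M M (\<Phi> g) p (X p)"
  proof (rule symp_form_eqI[OF sym q(1) Xt[OF q(1)] tangent_map_in_tangent_space[OF M(1) M(1) F p]])
    fix u assume u: "u \<in> tangent_space M ?q"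
    \<comment> \<open>Every u at g p is the image of this vector, since g acts invertibly.\<close>
    let ?v = "tangent_map M M (\<Phi> ?h) ?q u"
    have v: "?v \<in> tangent_space M p"
      using tangent_map_in_tangent_space[OF M(1) M(1) F' q(1)] q(2) by simp
    have uv: "u = tangent_map M M (\<Phi> g) p ?v"
      using tangent_map_compose[OF M(1) M(1) F' F q(1), of u]
        tangent_map_identity[OF M(1) _ q(1) u, of "\<Phi> g \<circ> \<Phi> ?h"] group_action_inv(3)[OF ga g] q(2)
      by simp
    have "differential M H ?q u = differential M (H \<circ> \<Phi> g) p ?v"
      using differential_tangent_map[OF M(1) M(1) F H(1) p, of ?v] uv by simp
    also have "\<dots> = differential M H p ?v"
      using differential_cong[OF M(1) p, of "H \<circ> \<Phi> g" H] H(2) g by (simp add: invariant_fun_def)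
    finally have "symp_form M \<theta> ?q u (X ?q) = differential M H p ?v - f p * \<theta> p ?v"
      using X\<omega>[OF q(1) u] inv[OF p v] uv f g p by (simp add: invariant_fun_def)
    also have "\<dots> = symp_form M \<theta> p ?v (X p)" using X\<omega>[OF p v] by simp
    also have "\<dots> = symp_form M \<theta> ?q (tangent_map M M (\<Phi> g) p ?v) (tangent_map M M (\<Phi> g) p (X p))"
      unfolding symp_form_def using ext_deriv_pullback[OF M F _ p, of ?v "X p"] inv by simp
    finally show "symp_form M \<theta> ?q u (X ?q) = symp_form M \<theta> ?q u (tangent_map M M (\<Phi> g) p (X p))"
      using uv by simp
  qed
qed


section \<open>The momentum map along integral curves\<close>

text \<open>
  This is \<open>dJ\<^sub>\<xi> = d\<theta>(\<cdot>, \<xi>\<^sub>M)\<close>.  The proof pulls \<open>\<theta>\<close> back along the action map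
  \<open>(a, x) \<mapsto> a \<cdot> x\<close>, in coordinates at \<open>(1, p)\<close>: evaluated on \<open>(\<xi>, 0)\<close> the pullback is \<open>J\<^sub>\<xi>\<close> along
  \<open>a = 1\<close>, and on \<open>(0, u)\<close> it does not depend on \<open>a\<close>, by invariance.
\<close>

lemma momentum_has_derivative:
  fixes M :: "('m, 'e::real_normed_vector) mfd" and L :: "('g, 'h::real_normed_vector) mfd"
  assumes lie: "lie_group G L" and M: "smooth_manifold M" and \<theta>: "smooth_one_form M \<theta>"
    and act: "smooth_action G L M \<Phi>" and inv\<theta>: "invariant_one_form G M \<Phi> \<theta>"
    and p: "p \<in> points M" and \<xi>: "\<xi> \<in> lie_algebra G L"
  defines "c \<equiv> some_chart M p"
  shows "((\<lambda>x. \<theta> (chart_inv c x) (inf_generator G L M \<Phi> \<xi> (chart_inv c x))) has_derivative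
    (\<lambda>u. ext_deriv M \<theta> p (coord_vec M c p u) (inf_generator G L M \<Phi> \<xi> p))) (at (snd c p))"
proof -
  have L: "smooth_manifold L" "points L = carrier G" "group G" using lie by (simp_all add: lie_group_def)
  have ga: "group_action G (points M) \<Phi>" and sm: "smooth_map (prod_mfd L M) M (\<lambda>(g, p). \<Phi> g p)"
    using act by (simp_all add: smooth_action_def)
  have one: "\<one>\<^bsub>G\<^esub> \<in> points L" using group.is_monoid[OF L(3)] monoid.one_closed L(2) by metis
  define c0 where "c0 = some_chart L \<one>\<^bsub>G\<^esub>"
  have c0: "c0 \<in> charts_at L \<one>\<^bsub>G\<^esub>" unfolding c0_def by (rule some_chart_in[OF L(1) one])
  have c: "c \<in> charts_at M p" unfolding c_def by (rule some_chart_in[OF M p])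
  note c0L = charts_atD[OF c0] and cM = charts_atD[OF c]
  let ?U = "snd c ` fst c" and ?x = "snd c p" and ?a = "snd c0 \<one>\<^bsub>G\<^esub>"
  \<comment> \<open>The points where the action returns to the chart c, so that c serves for source
    and target. It contains a neighbourhood of each (\<open>?a\<close>, y), as the identity acts
    trivially.\<close>
  define S where "S = {(a, x). a \<in> snd c0 ` fst c0 \<and> x \<in> ?U \<and> \<Phi> (chart_inv c0 a) (chart_inv c x) \<in> fst c}"
  define \<psi> where "\<psi> = (\<lambda>(a, x). snd c (\<Phi> (chart_inv c0 a) (chart_inv c x)))"
  have op: "open S" and sm\<psi>: "smooth_on \<psi> S"
    unfolding S_def \<psi>_def using smooth_prod_map_local[OF L(1) M M sm c0L(1) cM(1) cM(1)] by blast+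
  have x: "?x \<in> ?U" using cM by blast
  have a: "chart_inv c0 ?a = \<one>\<^bsub>G\<^esub>" using L(1) c0L by simp
  have pts: "chart_inv c y \<in> points M" if "y \<in> ?U" for y
    using chart_inv_in[OF that] chart_subset[OF M cM(1)] by blast
  have act1: "\<Phi> \<one>\<^bsub>G\<^esub> (chart_inv c y) = chart_inv c y" if "y \<in> ?U" for y
    using group_action_one[OF ga pts[OF that]] .
  have aS: "(?a, y) \<in> S" if "y \<in> ?U" for y
    using that c0L a act1[OF that] chart_inv_in[OF that] by (simp add: S_def)
  have \<psi>1: "\<psi> (?a, y) = y" if "y \<in> ?U" for y
    using that act1[OF that] a by (simp add: \<psi>_def)
  let ?A = "\<lambda>y e. form_coord M \<theta> c e y"
  let ?P = "\<lambda>w z. ?A (\<psi> z) (frechet_derivative \<psi> (at z) w)"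
  \<comment> \<open>The direction \<xi>, extended as a constant vector over the product
    chart.\<close>
  let ?w = "(\<xi> c0, 0)"
  obtain B :: "'e set" where B: "finite B" "span B = UNIV"
    using M unfolding smooth_manifold_def by blast
  have lin: "linear (?A (\<psi> z))" if "z \<in> S" for z
    using that by (intro linear_form_coord[OF M \<theta> cM(1)]) (auto simp: S_def \<psi>_def)
  have dif: "(\<lambda>y. ?A y e) differentiable (at (\<psi> (?a, ?x)))" for e
    unfolding \<psi>1[OF x] using form_coord_differentiable[OF \<theta> cM(1) x] by blast
  note pb = pullback_derivative[where A = ?A and F = \<psi>, OF B op aS[OF x]
      smooth_on_imp_differentiable(1)[OF sm\<psi>] smooth_on_imp_differentiable(2)[OF sm\<psi> aS[OF x]] lin dif]
  have J: "?P ?w (?a, y) = \<theta> (chart_inv c y) (inf_generator G L M \<Phi> \<xi> (chart_inv c y))"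
    and \<eta>: "frechet_derivative \<psi> (at (?a, y)) ?w = inf_generator G L M \<Phi> \<xi> (chart_inv c y) c" if y: "y \<in> ?U" for y
  proof -
    let ?q = "chart_inv c y" and ?\<eta> = "inf_generator G L M \<Phi> \<xi> (chart_inv c y)"
    have orb: "smooth_map L M (\<lambda>g. \<Phi> g ?q)"
      by (rule smooth_map_partial(2)[OF L(1) M M sm pts[OF y]])
    have cq: "c \<in> charts_at M ?q" using cM(1) chart_inv_in[OF y] by (simp add: charts_at_def)
    have t: "?\<eta> \<in> tangent_space M ?q"
      using tangent_map_in_tangent_space[OF L(1) M orb one] act1[OF y] by (simp add: inf_generator_def)
    have "?\<eta> c = frechet_derivative (snd c \<circ> (\<lambda>g. \<Phi> g ?q) \<circ> chart_inv c0) (at ?a) (\<xi> c0)"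
      unfolding inf_generator_def using \<xi> act1[OF y] cq
      by (intro tangent_map_apply[OF L(1) orb _ c0]) (simp_all add: lie_algebra_def)
    also have "snd c \<circ> (\<lambda>g. \<Phi> g ?q) \<circ> chart_inv c0 = (\<lambda>a. \<psi> (a, y))"
      by (simp add: \<psi>_def o_def)
    also have "frechet_derivative \<dots> (at ?a) (\<xi> c0) = frechet_derivative \<psi> (at (?a, y)) ?w"
      by (rule frechet_derivative_slice(2)[OF smooth_on_imp_differentiable(1)[OF sm\<psi> aS[OF y]]])
    finally show \<eta>: "frechet_derivative \<psi> (at (?a, y)) ?w = ?\<eta> c" by simp
    show "?P ?w (?a, y) = \<theta> ?q ?\<eta>"
      using form_coord_chart[OF M cq t, of \<theta>] \<psi>1[OF y] \<eta> y by simp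
  qed
  \<comment> \<open>For fixed b, the map \<open>\<lambda>y. \<psi> (b, y)\<close> is the action of
    one group element in coordinates, so invariance of \<theta> applies.\<close>
  have inv: "?P (0, u) (b, y) = ?A y u" if z: "(b, y) \<in> S" for b y u
  proof -
    let ?g = "chart_inv c0 b"
    have y: "y \<in> ?U" and im: "\<Phi> ?g (chart_inv c y) \<in> fst c" and b: "?g \<in> fst c0"
      using z by (auto simp: S_def)
    have g: "?g \<in> carrier G" using b chart_subset[OF L(1) c0L(1)] L(2) by blast
    have F: "smooth_map M M (\<Phi> ?g)"
      using smooth_map_partial(1)[OF L(1) M M sm] g L(2) by simp
    have "form_coord M \<theta> c (frechet_derivative (snd c \<circ> \<Phi> ?g \<circ> chart_inv c) (at y) u)
      ((snd c \<circ> \<Phi> ?g \<circ> chart_inv c) y) = form_coord M \<theta> c u y"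
      using inv\<theta> g by (intro form_coord_pullback M F cM(1) y im) (simp add: invariant_one_form_def)
    moreover have "snd c \<circ> \<Phi> ?g \<circ> chart_inv c = (\<lambda>y. \<psi> (b, y))"
      by (simp add: \<psi>_def o_def)
    ultimately show ?thesis
      using frechet_derivative_slice(1)[OF smooth_on_imp_differentiable(1)[OF sm\<psi> z], of u] by simp
  qed
  have id: "frechet_derivative \<psi> (at (?a, ?x)) (0, u) = u" for u
  proof -
    have "frechet_derivative (\<lambda>y. \<psi> (?a, y)) (at ?x) = frechet_derivative (\<lambda>y. y) (at ?x)"
      using \<psi>1 by (intro frechet_derivative_cong_open[OF chart_open_range[OF M cM(1)] x])
    then show ?thesis
      using frechet_derivative_slice(1)[OF smooth_on_imp_differentiable(1)[OF sm\<psi> aS[OF x]], of u]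
      by simp
  qed
  \<comment> \<open>\<open>?P (0, u)\<close> is constant along the group coordinate, the direction
    of \<open>?w\<close>.\<close>
  have zero: "frechet_derivative (?P (0, u)) (at (?a, ?x)) ?w = 0" for u
  proof -
    have ax: "isCont (\<lambda>b. (b, ?x)) b" for b by (intro continuous_intros)
    have "open {b. (b, ?x) \<in> S}"
      using open_vimage[OF op, of "\<lambda>b. (b, ?x)"] ax
      by (simp add: vimage_def continuous_at_imp_continuous_on)
    then have "frechet_derivative (\<lambda>b. ?P (0, u) (b, ?x)) (at ?a) = frechet_derivative (\<lambda>b. ?A ?x u) (at ?a)"
      by (rule frechet_derivative_cong_open) (use aS[OF x] inv in auto)
    then show ?thesis
      using frechet_derivative_slice(2)[OF pb(1), of "(0, u)" "\<xi> c0"] by simp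
  qed
  have Pw: "(?P ?w has_derivative frechet_derivative (?P ?w) (at (?a, ?x))) (at (?a, ?x))"
    using pb(1) frechet_derivative_works by blast
  have "((\<lambda>y. ?P ?w ((?a, 0) + (0, y))) has_derivative (\<lambda>u. frechet_derivative (?P ?w) (at (?a, ?x)) (0, u))) (at ?x)"
    using Pw by (intro has_derivative_compose_affine[OF bounded_linear_zero_Pair]) simp
  then have "((\<lambda>y. ?P ?w (?a, y)) has_derivative (\<lambda>u. frechet_derivative (?P ?w) (at (?a, ?x)) (0, u))) (at ?x)"
    by simp
  then have der: "((\<lambda>y. \<theta> (chart_inv c y) (inf_generator G L M \<Phi> \<xi> (chart_inv c y))) has_derivative
      (\<lambda>u. frechet_derivative (?P ?w) (at (?a, ?x)) (0, u))) (at ?x)"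
    by (rule has_derivative_transform_within_open[OF _ chart_open_range[OF M cM(1)] x J])
  have "frechet_derivative (?P ?w) (at (?a, ?x)) (0, u)
      = ext_deriv M \<theta> p (coord_vec M c p u) (inf_generator G L M \<Phi> \<xi> p)" for u
  proof -
    have cx: "chart_inv c ?x = p" using M cM by simp
    \<comment> \<open>On the left of the pullback identity \<open>zero\<close> leaves a single term;
      on the right \<open>id\<close> and \<open>\<eta>\<close> send the directions (0, u) and
      \<open>?w\<close> to u and \<xi>_M(p), which gives d\<theta>.\<close>
    have "frechet_derivative (?P ?w) (at (?a, ?x)) (0, u)
        = frechet_derivative (form_coord M \<theta> c (inf_generator G L M \<Phi> \<xi> p c)) (at ?x) u
        - frechet_derivative (form_coord M \<theta> c u) (at ?x) (inf_generator G L M \<Phi> \<xi> p c)"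
      using pb(2)[of ?w "(0, u)"] zero[of u] id[of u] \<eta>[OF x] \<psi>1[OF x] cx by simp
    then show ?thesis
      using coord_vec_self[OF M c, of u] by (simp add: ext_deriv_def c_def Let_def)
  qed
  then show ?thesis using der by simp
qed

text \<open>H is constant along the orbit map, so dH vanishes on \<xi>_M and only the \<theta> term
  of the defining equation remains.\<close>

lemma momentum_derivative_along:
  assumes lie: "lie_group G L" and sym: "exact_symplectic_manifold M \<theta>"
    and act: "smooth_action G L M \<Phi>" and inv\<theta>: "invariant_one_form G M \<Phi> \<theta>"
    and H: "smooth_fun M H" "invariant_fun G M \<Phi> H"
    and X: "conformal_hamiltonian M \<theta> H f X"
    and p: "p \<in> points M" and \<xi>: "\<xi> \<in> lie_algebra G L"
  shows "ext_deriv M \<theta> p (X p) (inf_generator G L M \<Phi> \<xi> p) = - f p * \<theta> p (inf_generator G L M \<Phi> \<xi> p)"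
proof -
  note M = exact_symplectic_manifoldD[OF sym]
  have L: "smooth_manifold L" "points L = carrier G" "group G" using lie by (simp_all add: lie_group_def)
  have ga: "group_action G (points M) \<Phi>" and sm: "smooth_map (prod_mfd L M) M (\<lambda>(g, p). \<Phi> g p)"
    using act by (simp_all add: smooth_action_def)
  have one: "\<one>\<^bsub>G\<^esub> \<in> points L" using group.is_monoid[OF L(3)] monoid.one_closed L(2) by metis
  have orb: "smooth_map L M (\<lambda>g. \<Phi> g p)"
    by (rule smooth_map_partial(2)[OF L(1) M(1) M(1) sm p])
  let ?\<eta> = "inf_generator G L M \<Phi> \<xi> p"
  have p1: "\<Phi> \<one>\<^bsub>G\<^esub> p = p" using group_action_one[OF ga p] .
  have t: "?\<eta> \<in> tangent_space M p"
    using tangent_map_in_tangent_space[OF L(1) M(1) orb one] p1 by (simp add: inf_generator_def)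
  have "differential M H p ?\<eta> = differential L (H \<circ> (\<lambda>g. \<Phi> g p)) \<one>\<^bsub>G\<^esub> \<xi>"
    using differential_tangent_map[OF L(1) M(1) orb H(1) one, of \<xi>] p1 by (simp add: inf_generator_def)
  also have "\<dots> = differential L (\<lambda>_. H p) \<one>\<^bsub>G\<^esub> \<xi>"
    using differential_cong[OF L(1) one, of "H \<circ> (\<lambda>g. \<Phi> g p)" "\<lambda>_. H p"] H(2) p L(2)
    by (simp add: invariant_fun_def)
  also have "\<dots> = 0" by (simp add: differential_def o_def Let_def)
  finally have "symp_form M \<theta> p ?\<eta> (X p) = - f p * \<theta> p ?\<eta>"
    using X p t by (simp add: conformal_hamiltonian_def interior_product_def)
  then show ?thesis using ext_deriv_swap[of M \<theta> p ?\<eta> "X p"] by (simp add: symp_form_def)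
qed

text \<open>Integrating factor: h exp(- K) has derivative zero on the interval I, hence is constant,
  and K vanishes at 0. The integral is oriented, which covers negative t.\<close>

lemma linear_ode_solution:
  fixes h \<phi> :: "real \<Rightarrow> real"
  assumes I: "open I" "is_interval I" "0 \<in> I" "t \<in> I"
    and \<phi>: "continuous_on I \<phi>"
    and h: "\<And>s. s \<in> I \<Longrightarrow> (h has_real_derivative \<phi> s * h s) (at s)"
  shows "h t = exp (LBINT s=0..t. \<phi> s) * h 0"
proof -
  let ?K = "\<lambda>u. LBINT s=0..u. \<phi> s"
  have K: "(?K has_real_derivative \<phi> s) (at s)" if s: "s \<in> I" for s
  proof -
    obtain \<epsilon> where \<epsilon>: "\<epsilon> > 0" "cball s \<epsilon> \<subseteq> I" using open_contains_cball I(1) s by blast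
    \<comment> \<open>A compact interval in I that contains the base point 0 and has s in its
      interior, so that the one-interval fundamental theorem gives a two-sided derivative at
      s.\<close>
    let ?a = "min 0 (s - \<epsilon>)" and ?b = "max 0 (s + \<epsilon>)"
    have "s - \<epsilon> \<in> I" "s + \<epsilon> \<in> I" using \<epsilon> by (auto simp: subset_iff dist_real_def)
    then have "?a \<in> I" "?b \<in> I" using I(3) by (auto simp: min_def max_def)
    then have sub: "{?a..?b} \<subseteq> I" using mem_is_interval_1_I[OF I(2)] by (meson atLeastAtMost_iff subsetI)
    have "(?K has_vector_derivative \<phi> s) (at s within {?a..?b})"
      using interval_integral_FTC2[of ?a 0 ?b \<phi> s] continuous_on_subset[OF \<phi> sub] \<epsilon>(1)
      by (simp add: zero_ereal_def)
    then have "(?K has_vector_derivative \<phi> s) (at s within {?a<..<?b})"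
      by (rule has_vector_derivative_within_subset) auto
    moreover have "at s within {?a<..<?b} = at s"
      using \<epsilon>(1) by (intro at_within_open) auto
    ultimately show ?thesis by (simp add: has_real_derivative_iff_has_vector_derivative)
  qed
  have "\<exists>k. \<forall>s\<in>I. exp (- ?K s) * h s = k"
  proof (rule has_field_derivative_zero_constant)
    show "convex I" using I(2) by (simp add: is_interval_convex_1)
    fix s assume s: "s \<in> I"
    have "((\<lambda>s. exp (- ?K s) * h s) has_real_derivative
        exp (- ?K s) * (- \<phi> s) * h s + (\<phi> s * h s) * exp (- ?K s)) (at s)"
      by (intro DERIV_mult h[OF s] DERIV_fun_exp DERIV_minus K[OF s])
    then show "((\<lambda>s. exp (- ?K s) * h s) has_real_derivative 0) (at s within I)"
      by (simp add: algebra_simps has_field_derivative_at_within)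
  qed
  then obtain k where k: "\<forall>s\<in>I. exp (- ?K s) * h s = k" ..
  have "exp (- ?K t) * h t = h 0"
    using bspec[OF k I(4)] bspec[OF k I(3)] by (simp add: zero_ereal_def)
  then have "exp (?K t) * (exp (- ?K t) * h t) = exp (?K t) * h 0" by simp
  moreover have "exp (?K t) * (exp (- ?K t) * h t) = h t"
    by (simp add: exp_minus)
  ultimately show ?thesis by simp
qed

text \<open>Continuity keeps the curve inside the chart for nearby times; there
  \<open>chart_inv c\<close> recovers x from its coordinates.\<close>

lemma integral_curve_near:
  assumes M: "smooth_manifold M" and x: "integral_curve M X I x" and t: "t \<in> I" and c: "c \<in> charts_at M (x t)"
  shows "open {s \<in> I. x s \<in> fst c}" "t \<in> {s \<in> I. x s \<in> fst c}"
    "(snd c \<circ> x has_vector_derivative X (x t) c) (at t)"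
proof -
  have I: "open I" and cont: "continuous_map (top_of_set I) (mtop M) x"
    using x by (simp_all add: integral_curve_def)
  have "openin (top_of_set I) {s \<in> I. x s \<in> fst c}"
    using openin_continuous_map_preimage[OF cont chart_openin[OF M charts_atD(1)[OF c]]] by simp
  then show "open {s \<in> I. x s \<in> fst c}" using I openin_open_eq by blast
  show "t \<in> {s \<in> I. x s \<in> fst c}" using t charts_atD(2)[OF c] by simp
  show "(snd c \<circ> x has_vector_derivative X (x t) c) (at t)"
    using x t c unfolding integral_curve_def by blast
qed

text \<open>Supplies the continuous coefficient for \<open>linear_ode_solution\<close>.\<close>

lemma continuous_on_along_integral_curve:
  assumes M: "smooth_manifold M" and x: "integral_curve M X I x" and f: "smooth_fun M f"
  shows "continuous_on I (\<lambda>s. f (x s))"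
proof (rule continuous_at_imp_continuous_on, intro ballI)
  fix t assume t: "t \<in> I"
  have "x t \<in> points M" using x t by (auto simp: integral_curve_def continuous_map_def)
  then obtain c where c: "c \<in> charts_at M (x t)" using some_chart_in[OF M] by blast
  note cM = charts_atD[OF c] and near = integral_curve_near[OF M x t c]
  have "isCont (snd c \<circ> x) t"
    using near(3) by (rule has_vector_derivative_continuous)
  moreover have "isCont (f \<circ> chart_inv c) ((snd c \<circ> x) t)"
    using has_derivative_continuous[OF smooth_fun_has_derivative[OF f c]] by simp
  ultimately have "isCont (\<lambda>s. (f \<circ> chart_inv c) ((snd c \<circ> x) s)) t"
    by (rule isCont_o2)
  moreover have "\<forall>\<^sub>F s in nhds t. (f \<circ> chart_inv c) ((snd c \<circ> x) s) = f (x s)"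
    unfolding eventually_nhds
    using near(1,2) M cM(1) by (intro exI[of _ "{s \<in> I. x s \<in> fst c}"]) auto
  ultimately show "isCont (\<lambda>s. f (x s)) t"
    using isCont_cong[of "\<lambda>s. (f \<circ> chart_inv c) ((snd c \<circ> x) s)" "\<lambda>s. f (x s)" t] by simp
qed

text \<open>Chain rule in \<open>some_chart M (x t)\<close>: the coordinate velocity of the curve
  represents X, so the derivative of the momentum is evaluated by
  \<open>momentum_derivative_along\<close>.\<close>

lemma momentum_derivative_along_curve:
  assumes lie: "lie_group G L" and sym: "exact_symplectic_manifold M \<theta>"
    and act: "smooth_action G L M \<Phi>" and inv\<theta>: "invariant_one_form G M \<Phi> \<theta>"
    and H: "smooth_fun M H" "invariant_fun G M \<Phi> H"
    and X: "conformal_hamiltonian M \<theta> H f X"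
    and \<xi>: "\<xi> \<in> lie_algebra G L" and x: "integral_curve M X I x" and t: "t \<in> I"
  shows "((\<lambda>s. \<theta> (x s) (inf_generator G L M \<Phi> \<xi> (x s))) has_real_derivative
    - f (x t) * \<theta> (x t) (inf_generator G L M \<Phi> \<xi> (x t))) (at t)"
proof -
  note M = exact_symplectic_manifoldD[OF sym]
  have p: "x t \<in> points M" using x t by (auto simp: integral_curve_def continuous_map_def)
  let ?c = "some_chart M (x t)"
  have c: "?c \<in> charts_at M (x t)" using some_chart_in[OF M(1) p] .
  note cM = charts_atD[OF c] and near = integral_curve_near[OF M(1) x t c]
  let ?J = "\<lambda>q. \<theta> q (inf_generator G L M \<Phi> \<xi> q)"
  let ?D = "\<lambda>u. ext_deriv M \<theta> (x t) (coord_vec M ?c (x t) u) (inf_generator G L M \<Phi> \<xi> (x t))"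
  have J: "((\<lambda>y. ?J (chart_inv ?c y)) has_derivative ?D) (at ((snd ?c \<circ> x) t))"
    using momentum_has_derivative[OF lie M act inv\<theta> p \<xi>] by simp
  have "((\<lambda>s. ?J (chart_inv ?c ((snd ?c \<circ> x) s))) has_derivative (\<lambda>r. ?D (r *\<^sub>R X (x t) ?c))) (at t)"
    using has_derivative_compose[OF near(3)[unfolded has_vector_derivative_def] J] .
  then have "((\<lambda>s. ?J (x s)) has_derivative (\<lambda>r. ?D (r *\<^sub>R X (x t) ?c))) (at t)"
    by (rule has_derivative_transform_within_open[OF _ near(1,2)]) (use M(1) cM(1) in auto)
  moreover have "(\<lambda>r. ?D (r *\<^sub>R X (x t) ?c)) = (*) (- f (x t) * ?J (x t))"
  proof
    fix r
    have "X (x t) \<in> tangent_space M (x t)"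
      using X p by (simp add: conformal_hamiltonian_def smooth_vector_field_def)
    then have "coord_vec M ?c (x t) (X (x t) ?c) = X (x t)"
      using tangent_eq_coord_vec c by metis
    then have "?D (X (x t) ?c) = - f (x t) * ?J (x t)"
      using momentum_derivative_along[OF lie sym act inv\<theta> H X p \<xi>] by simp
    then show "?D (r *\<^sub>R X (x t) ?c) = (- f (x t) * ?J (x t)) * r"
      using linear_cmul[OF bounded_linear.linear[OF has_derivative_bounded_linear[OF J]], of r "X (x t) ?c"]
      by simp
  qed
  ultimately show ?thesis by (simp add: has_field_derivative_def)
qed


theorem proposition4p2:
  fixes G :: "('g, 'z) monoid_scheme"
    and L :: "('g, 'h::real_normed_vector) mfd"
    and M :: "('m, 'e::real_normed_vector) mfd"
    and \<theta> :: "'m \<Rightarrow> ('m, 'e) tvec \<Rightarrow> real"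
    and \<Phi> :: "'g \<Rightarrow> 'm \<Rightarrow> 'm"
    and H f :: "'m \<Rightarrow> real"
    and X :: "'m \<Rightarrow> ('m, 'e) tvec"
  assumes "lie_group G L"
    and "exact_symplectic_manifold M \<theta>"
    and "smooth_action G L M \<Phi>"
    and "invariant_one_form G M \<Phi> \<theta>"
    and "smooth_fun M H" and "invariant_fun G M \<Phi> H"
    and "smooth_fun M f" and "invariant_fun G M \<Phi> f"
    and "conformal_hamiltonian M \<theta> H f X"
  shows "invariant_vector_field G M \<Phi> X \<and>
    (\<forall>I x. integral_curve M X I x \<and> 0 \<in> I \<longrightarrow>
       (\<forall>t\<in>I. momentum_map G L M \<Phi> \<theta> (x t) =
          coalg_scale G L (exp (LBINT s=0..t. - f (x s))) (momentum_map G L M \<Phi> \<theta> (x 0))) \<and>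
       (\<forall>\<mu>\<in>lie_coalgebra G L. \<forall>t\<in>I.
          x 0 \<in> ray_preimage G L M \<Phi> \<theta> \<mu> \<longrightarrow> x t \<in> ray_preimage G L M \<Phi> \<theta> \<mu>))"
proof (intro conjI allI impI)
  note sym = assms(2)
  have M: "smooth_manifold M" using exact_symplectic_manifoldD(1)[OF sym] .
  let ?J = "momentum_map G L M \<Phi> \<theta>"
  show "invariant_vector_field G M \<Phi> X"
    by (rule conformal_hamiltonian_invariant[OF assms(1-6,8,9)])
  fix I x assume asm: "integral_curve M X I x \<and> 0 \<in> I"
  then have x: "integral_curve M X I x" and 0: "0 \<in> I" by simp_all
  then have I: "open I" "is_interval I" by (simp_all add: integral_curve_def)
  have cont: "continuous_on I (\<lambda>s. - f (x s))"
    using continuous_on_along_integral_curve[OF M x assms(7)] by (intro continuous_intros)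
  show J: "\<forall>t\<in>I. ?J (x t) = coalg_scale G L (exp (LBINT s=0..t. - f (x s))) (?J (x 0))"
  proof
    fix t assume t: "t \<in> I"
    \<comment> \<open>The functionals are compared on one \<xi> at a time; off the Lie algebra both
      sides are \<open>undefined\<close> by restriction.\<close>
    have "\<theta> (x t) (inf_generator G L M \<Phi> \<xi> (x t))
        = exp (LBINT s=0..t. - f (x s)) * \<theta> (x 0) (inf_generator G L M \<Phi> \<xi> (x 0))"
      if "\<xi> \<in> lie_algebra G L" for \<xi>
      using linear_ode_solution[OF I 0 t cont
          momentum_derivative_along_curve[OF assms(1-6,9) that x]] .
    then show "?J (x t) = coalg_scale G L (exp (LBINT s=0..t. - f (x s))) (?J (x 0))"
      unfolding momentum_map_def coalg_scale_def by (intro restrict_ext) simp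
  qed
  show "\<forall>\<mu>\<in>lie_coalgebra G L. \<forall>t\<in>I.
      x 0 \<in> ray_preimage G L M \<Phi> \<theta> \<mu> \<longrightarrow> x t \<in> ray_preimage G L M \<Phi> \<theta> \<mu>"
  proof (intro ballI impI)
    fix \<mu> t assume t: "t \<in> I" and "x 0 \<in> ray_preimage G L M \<Phi> \<theta> \<mu>"
    then obtain r where r: "r > 0" "?J (x 0) = coalg_scale G L r \<mu>"
      by (auto simp: ray_preimage_def)
    \<comment> \<open>A positive factor, so the flow only rescales the ray parameter r.\<close>
    let ?e = "exp (LBINT s=0..t. - f (x s))"
    have "?J (x t) = coalg_scale G L ?e (coalg_scale G L r \<mu>)"
      unfolding r(2)[symmetric] by (rule bspec[OF J t])
    also have "\<dots> = coalg_scale G L (?e * r) \<mu>"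
      unfolding coalg_scale_def by (intro restrict_ext) simp
    finally have "?J (x t) = coalg_scale G L (?e * r) \<mu>" .
    moreover have "?e * r > 0" using r(1) by simp
    moreover have "x t \<in> points M" using x t by (auto simp: integral_curve_def continuous_map_def)
    ultimately show "x t \<in> ray_preimage G L M \<Phi> \<theta> \<mu>"
      unfolding ray_preimage_def by blast
  qed
qed

end
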